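(* Let $A$ be a local Noetherian integral domain and $p$ a prime ideal of $A$ such that $A_p$ is a rank-one discrete valuation ring. If $p^{(n)}=p^n$ for all $n\geq 0$, then $\dim(A)=1+\dim(A/p)$.
   Context: For $n\ge0$, $p^{(n)}:=p^nA_p\cap A$ is the $n$th symbolic power of $p$ (with $p^{(0)}=A$). $\dim$ denotes Krull dimension. *)

theory Defs
  imports "HOL-Algebra.Ring_Divisibility" "HOL-Algebra.Ideal_Product" "HOL-Library.Extended_Nat"
begin

subsection \<open>Local rings, discrete valuation rings, Krull dimension\<close>

locale local_ring = cring +
  assumes ex1_maximalideal: "\<exists>!m. maximalideal m R"

text \<open>
  Rank-one discrete valuation rings in the usual sense: local principal ideal domains that are
  not fields. Excluding fields excludes the trivial valuation, so that the value group is
  infinite cyclic.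
\<close>

locale discrete_valuation_ring = principal_domain R + local_ring R for R (structure) +
  assumes not_field: "\<not> field R"

text \<open>
  The supremum of the lengths of the chains \<open>P 0 \<subset> P 1 \<subset> \<dots> \<subset> P n\<close> of prime ideals. The zero
  ring, which has no prime ideals, gets the value 0 here.
\<close>

definition krull_dim :: "('a, 'b) ring_scheme \<Rightarrow> enat"
  where "krull_dim R =
    Sup {enat n | n. \<exists>P. (\<forall>i\<le>n. primeideal (P i) R) \<and> (\<forall>i<n. P i \<subset> P (Suc i))}"


subsection \<open>Localization\<close>

text \<open>
  \<open>fraction R S a s\<close> is the fraction \<open>a / s\<close>: the class of \<open>(a, s)\<close> in \<open>carrier R \<times> S\<close>, where
  \<open>(a, s)\<close> and \<open>(b, t)\<close> are equivalent if some element of \<open>S\<close> annihilates \<open>at - bs\<close>. The set \<open>S\<close>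
  is meant to be a multiplicative submonoid of the commutative ring \<open>R\<close>.
\<close>

definition fraction :: "('a, 'b) ring_scheme \<Rightarrow> 'a set \<Rightarrow> 'a \<Rightarrow> 'a \<Rightarrow> ('a \<times> 'a) set"
  where "fraction R S a s =
    {(b, t). b \<in> carrier R \<and> t \<in> S \<and>
      (\<exists>u\<in>S. u \<otimes>\<^bsub>R\<^esub> ((a \<otimes>\<^bsub>R\<^esub> t) \<ominus>\<^bsub>R\<^esub> (b \<otimes>\<^bsub>R\<^esub> s)) = \<zero>\<^bsub>R\<^esub>)}"

text \<open>
  The operations are written as unions over all representatives, as for \<^const>\<open>rcoset_mult\<close>; all
  the sets in such a union are equal.
\<close>

definition localization :: "('a, 'b) ring_scheme \<Rightarrow> 'a set \<Rightarrow> ('a \<times> 'a) set ring"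
  where "localization R S =
    \<lparr>carrier = {fraction R S a s | a s. a \<in> carrier R \<and> s \<in> S},
     mult = (\<lambda>U V. \<Union>(a, s)\<in>U. \<Union>(b, t)\<in>V. fraction R S (a \<otimes>\<^bsub>R\<^esub> b) (s \<otimes>\<^bsub>R\<^esub> t)),
     one = fraction R S \<one>\<^bsub>R\<^esub> \<one>\<^bsub>R\<^esub>,
     zero = fraction R S \<zero>\<^bsub>R\<^esub> \<one>\<^bsub>R\<^esub>,
     add = (\<lambda>U V. \<Union>(a, s)\<in>U. \<Union>(b, t)\<in>V.
              fraction R S ((a \<otimes>\<^bsub>R\<^esub> t) \<oplus>\<^bsub>R\<^esub> (b \<otimes>\<^bsub>R\<^esub> s)) (s \<otimes>\<^bsub>R\<^esub> t))\<rparr>"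

definition localization_at :: "('a, 'b) ring_scheme \<Rightarrow> 'a set \<Rightarrow> ('a \<times> 'a) set ring"
  where "localization_at R p = localization R (carrier R - p)"

definition to_localization_at :: "('a, 'b) ring_scheme \<Rightarrow> 'a set \<Rightarrow> 'a \<Rightarrow> ('a \<times> 'a) set"
  where "to_localization_at R p a = fraction R (carrier R - p) a \<one>\<^bsub>R\<^esub>"


subsection \<open>Symbolic powers\<close>

text \<open>
  Powers in \<^const>\<open>ideals_set\<close> are powers with respect to the product of ideals; the 0th power is
  the whole ring. The intersection of the extended ideal with \<open>R\<close> is the preimage under the
  canonical map from \<open>R\<close> to its localization.
\<close>

definition symbolic_power :: "('a, 'b) ring_scheme \<Rightarrow> 'a set \<Rightarrow> nat \<Rightarrow> 'a set"
  where "symbolic_power R p n =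
    {a \<in> carrier R. to_localization_at R p a \<in>
      Idl\<^bsub>localization_at R p\<^esub> (to_localization_at R p ` (p [^]\<^bsub>ideals_set R\<^esub> n))}"

end

theory Submission
  imports Defs "HOL-Library.Product_Plus"
begin

text \<open>
  If \<open>d = dim (A/p)\<close>, the length of \<open>A/(p + m\<^sup>k)\<close> grows at most like \<open>k\<^sup>d\<close>, whereas a chain of primes
  of length \<open>N\<close> makes the length of \<open>A/m\<^sup>n\<close> grow at least like \<open>n\<^sup>N\<close>. The theorem therefore reduces to
  bounding the length of \<open>A/m\<^sup>n\<close> by a constant times \<open>n\<^sup>d\<^sup>+\<^sup>1\<close>. Filter \<open>A\<close> by the powers of \<open>p\<close>.
  Since \<open>A\<^sub>p\<close> is a discrete valuation ring and the powers of \<open>p\<close> are symbolic, \<open>p\<^sup>i/p\<^sup>i\<^sup>+\<^sup>1\<close> is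
  isomorphic to \<open>J\<^sup>i(A/p)\<close> for a fixed ideal \<open>J\<close>. By the Artin-Rees theorem for the Rees algebra of the
  two ideals \<open>m\<close> and \<open>J\<close> there is an \<open>e\<close>, independent of \<open>i\<close>, such that in \<open>A/p\<close> the intersection of
  \<open>J\<^sup>i\<close> and \<open>m\<^sup>k\<^sup>+\<^sup>e\<^sup>i\<close> lies in \<open>m\<^sup>kJ\<^sup>i\<close>. So each of the \<open>n\<close> graded pieces of \<open>A/m\<^sup>n\<close> is at most
  as long as \<open>A/(p + m\<^sup>k)\<close> with \<open>k\<close> linear in \<open>n\<close>.
\<close>

section \<open>Lengths between ideals\<close>

text \<open>Applied to each \<open>J^i\<close> separately, Artin-Rees would give constants depending
  on i without control. A loss linear in i keeps all exponents below (1 + e)n, so the n graded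
  pieces together have length at most n * c * ((1 + e)n + 1)^d, which is of degree d + 1. This is
  why the Rees algebra of both ideals has to be Noetherian. The ideal J arises because a uniformizer
  \<pi> generates p only after localization: with one denominator s for the finitely many generators
  of p one has sp \<subseteq> \<pi>A, and J = (sp : \<pi>) records the discrepancy. Degrees are
  compared through upper bounds along coheight and binomial lower bounds along chains of primes.
  Lengths are expressed by chains of ideals between two ideals, and A/p by adding p to ideals;
  quotient rings enter only when dimensions are translated. The inequality dim A \<ge> 1 + dim (A/p)
  is the easy half: 0 is prime and lies strictly below p, because the localization is not a
  field.\<close>

context ring
begin

lemma set_add_iff: "x \<in> I <+>\<^bsub>R\<^esub> J \<longleftrightarrow> (\<exists>i\<in>I. \<exists>j\<in>J. x = i \<oplus> j)"
  by (auto simp: set_add_def')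

lemma set_addI: "\<lbrakk>i \<in> I; j \<in> J\<rbrakk> \<Longrightarrow> i \<oplus> j \<in> I <+>\<^bsub>R\<^esub> J"
  using set_add_iff by blast

lemma set_addE:
  assumes "x \<in> I <+>\<^bsub>R\<^esub> J"
  obtains i j where "i \<in> I" "j \<in> J" "x = i \<oplus> j"
  using assms set_add_iff by blast

lemma ideal_zero_mem: "ideal I R \<Longrightarrow> \<zero> \<in> I"
  by (simp add: additive_subgroup.zero_closed ideal.axioms(1))

lemma ideal_add_mem: "\<lbrakk>ideal I R; a \<in> I; b \<in> I\<rbrakk> \<Longrightarrow> a \<oplus> b \<in> I"
  by (simp add: additive_subgroup.a_closed ideal.axioms(1))

lemma ideal_minus_mem: "\<lbrakk>ideal I R; a \<in> I; b \<in> I\<rbrakk> \<Longrightarrow> a \<ominus> b \<in> I"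
  unfolding a_minus_def
  by (simp add: additive_subgroup.a_closed additive_subgroup.a_inv_closed ideal.axioms(1))

lemma ideal_subset_carrier: "ideal I R \<Longrightarrow> I \<subseteq> carrier R"
  by (meson ideal.Icarr subsetI)

lemma minus_add_cancel: "\<lbrakk>a \<in> carrier R; b \<in> carrier R\<rbrakk> \<Longrightarrow> (a \<ominus> b) \<oplus> b = a"
  by (simp add: a_minus_def a_assoc l_neg)

lemma subset_set_add:
  assumes "ideal I R" "ideal J R"
  shows "I \<subseteq> I <+>\<^bsub>R\<^esub> J" "J \<subseteq> I <+>\<^bsub>R\<^esub> J"
proof -
  show "I \<subseteq> I <+>\<^bsub>R\<^esub> J"
  proof
    fix x assume "x \<in> I"
    then have "x = x \<oplus> \<zero>" using assms by (simp add: ideal.Icarr)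
    then show "x \<in> I <+>\<^bsub>R\<^esub> J"
      using \<open>x \<in> I\<close> ideal_zero_mem[OF assms(2)] set_add_iff by blast
  qed
  show "J \<subseteq> I <+>\<^bsub>R\<^esub> J"
  proof
    fix x assume "x \<in> J"
    then have "x = \<zero> \<oplus> x" using assms by (simp add: ideal.Icarr)
    then show "x \<in> I <+>\<^bsub>R\<^esub> J"
      using \<open>x \<in> J\<close> ideal_zero_mem[OF assms(1)] set_add_iff by blast
  qed
qed

lemma set_add_least:
  assumes "ideal K R" "I \<subseteq> K" "J \<subseteq> K"
  shows "I <+>\<^bsub>R\<^esub> J \<subseteq> K"
  using assms ideal_add_mem[OF assms(1)] unfolding set_add_def' by blast

lemma set_add_mono: "\<lbrakk>I \<subseteq> I'; J \<subseteq> J'\<rbrakk> \<Longrightarrow> I <+>\<^bsub>R\<^esub> J \<subseteq> I' <+>\<^bsub>R\<^esub> J'"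
  unfolding set_add_def' by blast

text \<open>Chains of submodules of \<open>I/K\<close>, written as ideals of the ring itself. A
  chain need not start at \<open>K\<close> or end at \<open>I\<close>.\<close>

definition ideal_chain :: "'a set \<Rightarrow> 'a set \<Rightarrow> nat \<Rightarrow> bool"
  where "ideal_chain K I l \<longleftrightarrow>
    (\<exists>C. (\<forall>j\<le>l. ideal (C j) R \<and> K \<subseteq> C j \<and> C j \<subseteq> I) \<and> (\<forall>j<l. C j \<subset> C (Suc j)))"

text \<open>Stands for: the module \<open>I/K\<close> has length at most \<open>n\<close>. If
  \<open>K\<close> is not contained in \<open>I\<close> there is no chain and the bound is
  vacuous.\<close>

definition length_le :: "'a set \<Rightarrow> 'a set \<Rightarrow> nat \<Rightarrow> bool"
  where "length_le K I n \<longleftrightarrow> (\<forall>l. ideal_chain K I l \<longrightarrow> l \<le> n)"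

lemma ideal_chain_mono: "\<lbrakk>ideal_chain K I l; K' \<subseteq> K; I \<subseteq> I'\<rbrakk> \<Longrightarrow> ideal_chain K' I' l"
  unfolding ideal_chain_def by (meson order_trans)

lemma length_le_mono: "\<lbrakk>length_le K I n; K \<subseteq> K'; I' \<subseteq> I; n \<le> n'\<rbrakk> \<Longrightarrow> length_le K' I' n'"
  unfolding length_le_def by (meson ideal_chain_mono order_trans)

lemma length_le_self: "length_le I I n"
  unfolding length_le_def
proof (intro allI impI)
  fix l assume "ideal_chain I I l"
  then obtain C where C: "\<And>j. j \<le> l \<Longrightarrow> I \<subseteq> C j \<and> C j \<subseteq> I" "\<And>j. j < l \<Longrightarrow> C j \<subset> C (Suc j)"
    unfolding ideal_chain_def by auto
  have "l = 0"
    using C(2)[of 0] C(1)[of 0] C(1)[of "Suc 0"] by fastforce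
  then show "l \<le> n" by simp
qed

lemma ideal_chain_0: "\<lbrakk>ideal I R; K \<subseteq> I\<rbrakk> \<Longrightarrow> ideal_chain K I 0"
  unfolding ideal_chain_def by (intro exI[of _ "\<lambda>_. I"]) auto

lemma ideal_chain_append:
  assumes "ideal_chain K L a" "ideal_chain L I b" "ideal L R" "K \<subseteq> L" "L \<subseteq> I"
  shows "ideal_chain K I (a + b)"
proof -
  obtain C where C: "\<And>j. j \<le> a \<Longrightarrow> ideal (C j) R \<and> K \<subseteq> C j \<and> C j \<subseteq> L"
      "\<And>j. j < a \<Longrightarrow> C j \<subset> C (Suc j)"
    using assms(1) unfolding ideal_chain_def by blast
  obtain D where D: "\<And>j. j \<le> b \<Longrightarrow> ideal (D j) R \<and> L \<subseteq> D j \<and> D j \<subseteq> I"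
      "\<And>j. j < b \<Longrightarrow> D j \<subset> D (Suc j)"
    using assms(2) unfolding ideal_chain_def by blast
  \<comment> \<open>\<open>D 0\<close> is dropped: since
    \<open>C a \<subseteq> L \<subseteq> D 0\<close>, the ideal \<open>C a\<close> takes its place
    and the first step of \<open>D\<close> stays strict.\<close>
  define E where "E j = (if j \<le> a then C j else D (j - a))" for j
  have "ideal (E j) R \<and> K \<subseteq> E j \<and> E j \<subseteq> I" if "j \<le> a + b" for j
  proof (cases "j \<le> a")
    case True
    then show ?thesis using C(1)[of j] assms(5) unfolding E_def by auto
  next
    case False
    then have "j - a \<le> b" using that by linarith
    then show ?thesis using D(1)[of "j - a"] assms(4) False unfolding E_def by auto
  qed
  moreover have "E j \<subset> E (Suc j)" if j: "j < a + b" for j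
  proof -
    consider "j < a" | "j = a" | "j > a" by linarith
    then show ?thesis
    proof cases
      case 1 then show ?thesis using C(2) by (simp add: E_def)
    next
      case 2
      then have "C a \<subseteq> L" "L \<subseteq> D 0" "D 0 \<subset> D (Suc 0)" using C(1)[of a] D(1)[of 0] D(2)[of 0] j by auto
      then show ?thesis using 2 by (auto simp: E_def)
    next
      case 3
      then show ?thesis using D(2)[of "j - a"] j by (simp add: E_def Suc_diff_le)
    qed
  qed
  ultimately show ?thesis unfolding ideal_chain_def by blast
qed

lemma ideal_chain_1: "\<lbrakk>ideal K R; ideal I R; K \<subset> I\<rbrakk> \<Longrightarrow> ideal_chain K I 1"
  unfolding ideal_chain_def by (intro exI[of _ "\<lambda>j. if j = 0 then K else I"]) auto

text \<open>Modular law: if \<open>x = c + l\<close> with \<open>x\<close> in \<open>D\<close>, then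
  \<open>l = x - c\<close> lies in both \<open>D\<close> and \<open>L\<close>, hence in
  \<open>C\<close>. So a strict step must show in the trace on \<open>L\<close> or in the sum with
  \<open>L\<close>.\<close>

lemma modular_cancel:
  assumes "ideal C R" "ideal D R" "ideal L R" "C \<subseteq> D"
    and int: "D \<inter> L \<subseteq> C \<inter> L" and sum: "D <+>\<^bsub>R\<^esub> L \<subseteq> C <+>\<^bsub>R\<^esub> L"
  shows "D \<subseteq> C"
proof
  fix x assume x: "x \<in> D"
  then have "x \<in> C <+>\<^bsub>R\<^esub> L" using sum subset_set_add(1)[OF assms(2,3)] by blast
  then obtain c l where cl: "c \<in> C" "l \<in> L" "x = c \<oplus> l" unfolding set_add_iff by blast
  then have carr: "c \<in> carrier R" "l \<in> carrier R" "x \<in> carrier R"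
    using assms x by (meson ideal.Icarr)+
  have "l = x \<ominus> c"
    using cl carr a_comm[of c l] by (simp add: a_minus_def a_assoc r_neg)
  then have "l \<in> D" using ideal_minus_mem[OF assms(2)] x cl assms(4) by blast
  then have "l \<in> C" using cl int by blast
  then show "x \<in> C" using cl ideal_add_mem assms(1) by blast
qed

text \<open>Each step of a chain is strict in its trace on \<open>L\<close> or in its sum with \<open>L\<close>.\<close>

lemma ideal_chain_split:
  assumes "ideal L R" "K \<subseteq> L" "L \<subseteq> I" "ideal I R"
    and "\<And>j. j \<le> l \<Longrightarrow> ideal (C j) R \<and> K \<subseteq> C j \<and> C j \<subseteq> I"
    and "\<And>j. j < l \<Longrightarrow> C j \<subset> C (Suc j)"
  shows "\<exists>a b. ideal_chain K (C l \<inter> L) a \<and> ideal_chain L (C l <+>\<^bsub>R\<^esub> L) b \<and> l \<le> a + b"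
  using assms(5,6)
proof (induction l)
  case 0
  then have "ideal (C 0) R" "K \<subseteq> C 0" by auto
  then have "ideal_chain K (C 0 \<inter> L) 0" "ideal_chain L (C 0 <+>\<^bsub>R\<^esub> L) 0"
    using assms(1,2) i_intersect add_ideals subset_set_add(2)[of "C 0" L]
    by (auto intro!: ideal_chain_0)
  then show ?case by fastforce
next
  case (Suc l)
  then obtain a b where ab: "ideal_chain K (C l \<inter> L) a" "ideal_chain L (C l <+>\<^bsub>R\<^esub> L) b" "l \<le> a + b"
    by force
  have CC: "ideal (C l) R" "ideal (C (Suc l)) R" "C l \<subset> C (Suc l)" "K \<subseteq> C l"
    using Suc.prems(1)[of l] Suc.prems(1)[of "Suc l"] Suc.prems(2)[of l] by auto
  note ids = i_intersect[OF CC(1) assms(1)] i_intersect[OF CC(2) assms(1)]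
    add_ideals[OF CC(1) assms(1)] add_ideals[OF CC(2) assms(1)]
  have sub: "C l \<inter> L \<subseteq> C (Suc l) \<inter> L" "C l <+>\<^bsub>R\<^esub> L \<subseteq> C (Suc l) <+>\<^bsub>R\<^esub> L"
    using CC set_add_mono by auto
  consider "C l \<inter> L \<subset> C (Suc l) \<inter> L" | "C l <+>\<^bsub>R\<^esub> L \<subset> C (Suc l) <+>\<^bsub>R\<^esub> L"
    using modular_cancel[OF CC(1,2) assms(1)] CC(3) sub by blast
  then show ?case
  proof cases
    case 1
    have "ideal_chain K (C (Suc l) \<inter> L) (a + 1)"
      using ideal_chain_append[OF ab(1) ideal_chain_1[OF ids(1,2) 1]] ids CC assms(2) 1 by auto
    moreover have "ideal_chain L (C (Suc l) <+>\<^bsub>R\<^esub> L) b"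
      using ideal_chain_mono[OF ab(2)] sub by blast
    ultimately show ?thesis using ab(3) by (metis Suc_eq_plus1 add.assoc add.commute add_le_cancel_right)
  next
    case 2
    have "ideal_chain L (C (Suc l) <+>\<^bsub>R\<^esub> L) (b + 1)"
      using ideal_chain_append[OF ab(2) ideal_chain_1[OF ids(3,4) 2] ids(3)]
        subset_set_add(2)[OF CC(1) assms(1)] 2 by auto
    moreover have "ideal_chain K (C (Suc l) \<inter> L) a"
      using ideal_chain_mono[OF ab(1)] sub by blast
    ultimately show ?thesis using ab(3) by (metis Suc_eq_plus1 add.assoc add_le_cancel_right)
  qed
qed

text \<open>The half of additivity of length that gives upper bounds; the other half is
  \<open>ideal_chain_append\<close>. The traces of a chain on \<open>L\<close> and its sums with
  \<open>L\<close> together lose no step.\<close>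

lemma length_le_add:
  assumes "length_le K L a" "length_le L I b" "ideal L R" "ideal I R" "K \<subseteq> L" "L \<subseteq> I"
  shows "length_le K I (a + b)"
  unfolding length_le_def
proof (intro allI impI)
  fix l assume "ideal_chain K I l"
  then obtain C where C: "\<And>j. j \<le> l \<Longrightarrow> ideal (C j) R \<and> K \<subseteq> C j \<and> C j \<subseteq> I"
      "\<And>j. j < l \<Longrightarrow> C j \<subset> C (Suc j)"
    unfolding ideal_chain_def by blast
  obtain a' b' where ab: "ideal_chain K (C l \<inter> L) a'" "ideal_chain L (C l <+>\<^bsub>R\<^esub> L) b'" "l \<le> a' + b'"
    using ideal_chain_split[where C = C, OF assms(3,5,6,4) C] by blast
  have "ideal_chain K L a'" using ideal_chain_mono[OF ab(1)] by blast
  moreover have "ideal_chain L I b'"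
    using ideal_chain_mono[OF ab(2)] set_add_least[OF assms(4)] C(1)[of l] assms(6) by blast
  ultimately show "l \<le> a + b" using assms(1,2) ab(3) unfolding length_le_def by fastforce
qed

end

section \<open>Lengths under linear maps and intersections\<close>

context cring
begin

lemma idealI_comm:
  assumes "I \<subseteq> carrier R" "\<zero> \<in> I"
    and "\<And>a b. \<lbrakk>a \<in> I; b \<in> I\<rbrakk> \<Longrightarrow> a \<oplus> b \<in> I"
    and mul: "\<And>r a. \<lbrakk>r \<in> carrier R; a \<in> I\<rbrakk> \<Longrightarrow> r \<otimes> a \<in> I"
  shows "ideal I R"
proof -
  have "subgroup I (add_monoid R)"
  proof (rule add.subgroupI)
    fix a assume a: "a \<in> I"
    then have "\<ominus> a = (\<ominus> \<one>) \<otimes> a" using assms(1) by (simp add: l_minus subsetD)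
    then show "\<ominus> a \<in> I" using a mul by simp
  qed (use assms in auto)
  then show ?thesis
    using assms(1) mul by (intro idealI ring_axioms) (auto, metis m_comm subsetD)
qed

text \<open>Preimages under \<open>f\<close> turn a chain between \<open>L'\<close> and
  \<open>I'\<close> into one between \<open>Q\<close> and \<open>I\<close>; as \<open>f\<close> is
  onto \<open>I'\<close> modulo \<open>L'\<close>, strict steps stay strict. Linearity is demanded
  on \<open>I\<close> only, because the map used for powers of \<open>p\<close> is given by a
  division that makes sense only there.\<close>

lemma length_le_image:
  assumes len: "length_le Q I n" and I: "ideal I R" and QI: "Q \<subseteq> I"
    and fc: "\<And>y. y \<in> I \<Longrightarrow> f y \<in> carrier R"
    and fadd: "\<And>y z. \<lbrakk>y \<in> I; z \<in> I\<rbrakk> \<Longrightarrow> f (y \<oplus> z) = f y \<oplus> f z"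
    and fmul: "\<And>r y. \<lbrakk>r \<in> carrier R; y \<in> I\<rbrakk> \<Longrightarrow> f (r \<otimes> y) = r \<otimes> f y"
    and fQ: "\<And>y. y \<in> Q \<Longrightarrow> f y \<in> L'"
    and onto: "\<And>z. z \<in> I' \<Longrightarrow> \<exists>y\<in>I. \<exists>k\<in>L'. z = f y \<oplus> k"
  shows "length_le L' I' n"
  unfolding length_le_def
proof (intro allI impI)
  fix l assume "ideal_chain L' I' l"
  then obtain D where D: "\<And>j. j \<le> l \<Longrightarrow> ideal (D j) R \<and> L' \<subseteq> D j \<and> D j \<subseteq> I'"
      "\<And>j. j < l \<Longrightarrow> D j \<subset> D (Suc j)"
    unfolding ideal_chain_def by blast
  define C where "C j = {y \<in> I. f y \<in> D j}" for j
  have Ic: "\<And>y. y \<in> I \<Longrightarrow> y \<in> carrier R" using ideal.Icarr[OF I] by blast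
  have "ideal (C j) R \<and> Q \<subseteq> C j \<and> C j \<subseteq> I" if "j \<le> l" for j
  proof -
    have Dj: "ideal (D j) R" "L' \<subseteq> D j" using D that by blast+
    have z: "f \<zero> = \<zero>" using fmul[of \<zero> \<zero>] fc ideal_zero_mem[OF I] by simp
    have "ideal (C j) R"
      by (rule idealI_comm)
        (auto simp: C_def Ic z ideal_zero_mem[OF I] ideal_zero_mem[OF Dj(1)] fadd fmul
          ideal_add_mem[OF I] ideal_add_mem[OF Dj(1)] ideal.I_l_closed[OF I] ideal.I_l_closed[OF Dj(1)])
    then show ?thesis using QI fQ Dj(2) by (auto simp: C_def)
  qed
  moreover have "C j \<subset> C (Suc j)" if j: "j < l" for j
  proof -
    have Dj: "ideal (D j) R" "L' \<subseteq> D j" "ideal (D (Suc j)) R" "D (Suc j) \<subseteq> I'" "D j \<subset> D (Suc j)"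
      using D(1)[of j] D(1)[of "Suc j"] D(2)[of j] j by auto
    then obtain z where z: "z \<in> D (Suc j)" "z \<notin> D j" by blast
    then obtain y k where yk: "y \<in> I" "k \<in> L'" "z = f y \<oplus> k" using onto Dj by blast
    have k: "k \<in> D j" "k \<in> D (Suc j)" "k \<in> carrier R"
      using yk Dj ideal.Icarr[OF Dj(1)] by auto
    have "f y = z \<ominus> k" using yk k fc by (simp add: a_minus_def a_assoc r_neg)
    then have "f y \<in> D (Suc j)" using ideal_minus_mem[OF Dj(3)] z k by simp
    moreover have "f y \<notin> D j" using z(2) yk(3) k(1) ideal_add_mem[OF Dj(1)] by blast
    ultimately show ?thesis using Dj yk by (auto simp: C_def)
  qed
  ultimately have "ideal_chain Q I l" unfolding ideal_chain_def by blast
  then show "l \<le> n" using len length_le_def by blast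
qed

text \<open>\<open>I/(I \<inter> T)\<close> embeds into \<open>R/T\<close>: adding \<open>T\<close>
  to a chain keeps it strict, as all its members have the same trace on \<open>T\<close>.\<close>

lemma length_le_inter:
  assumes len: "length_le T (carrier R) n" and T: "ideal T R" and I: "ideal I R"
  shows "length_le (I \<inter> T) I n"
  unfolding length_le_def
proof (intro allI impI)
  fix l assume "ideal_chain (I \<inter> T) I l"
  then obtain C where C: "\<And>j. j \<le> l \<Longrightarrow> ideal (C j) R \<and> I \<inter> T \<subseteq> C j \<and> C j \<subseteq> I"
      "\<And>j. j < l \<Longrightarrow> C j \<subset> C (Suc j)"
    unfolding ideal_chain_def by blast
  define D where "D j = C j <+>\<^bsub>R\<^esub> T" for j
  have "ideal (D j) R \<and> T \<subseteq> D j \<and> D j \<subseteq> carrier R" if "j \<le> l" for j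
    using C(1)[OF that] T add_ideals[of "C j" T] subset_set_add(2)[of "C j" T]
      ideal_subset_carrier[of "C j <+>\<^bsub>R\<^esub> T"] unfolding D_def by auto
  moreover have "D j \<subset> D (Suc j)" if j: "j < l" for j
  proof -
    have C': "ideal (C j) R" "ideal (C (Suc j)) R" "C j \<subset> C (Suc j)" "I \<inter> T \<subseteq> C j" "C (Suc j) \<subseteq> I"
      using C(1)[of j] C(1)[of "Suc j"] C(2)[of j] j by auto
    then have "C (Suc j) \<inter> T \<subseteq> C j \<inter> T" by blast
    then have "\<not> D (Suc j) \<subseteq> D j"
      using modular_cancel[OF C'(1,2) T] C'(3) unfolding D_def by blast
    moreover have "D j \<subseteq> D (Suc j)" using C' set_add_mono unfolding D_def by auto
    ultimately show ?thesis by blast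
  qed
  ultimately have "ideal_chain T (carrier R) l" unfolding ideal_chain_def by blast
  then show "l \<le> n" using len length_le_def by blast
qed

end

section \<open>Graded Noetherian families\<close>

text \<open>Serves as the degree of the \<open>n\<close>-th power of an element of degree
  \<open>h\<close>.\<close>

primrec nat_mult :: "nat \<Rightarrow> 'g::ab_group_add \<Rightarrow> 'g"
  where "nat_mult 0 h = 0" | "nat_mult (Suc n) h = nat_mult n h + h"

context cring
begin

text \<open>
  A family \<open>W\<close> of additive subgroups of \<open>R\<close> indexed by a group \<open>G\<close> stands for the graded subring
  \<open>\<Oplus>\<^sub>g W\<^sub>g T\<^sup>g\<close> of the group ring \<open>R[G]\<close>; Noetherianity refers to its homogeneous ideals.
\<close>

definition graded_subring :: "('g::ab_group_add \<Rightarrow> 'a set) \<Rightarrow> bool"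
  where "graded_subring W \<longleftrightarrow> (\<forall>g. W g \<subseteq> carrier R \<and> \<zero> \<in> W g) \<and>
    (\<forall>g. \<forall>a\<in>W g. \<forall>b\<in>W g. a \<ominus> b \<in> W g) \<and> \<one> \<in> W 0 \<and>
    (\<forall>g h. \<forall>a\<in>W g. \<forall>b\<in>W h. a \<otimes> b \<in> W (g + h))"

definition graded_ideal :: "('g::ab_group_add \<Rightarrow> 'a set) \<Rightarrow> ('g \<Rightarrow> 'a set) \<Rightarrow> bool"
  where "graded_ideal W F \<longleftrightarrow> (\<forall>g. F g \<subseteq> W g \<and> \<zero> \<in> F g) \<and>
    (\<forall>g. \<forall>a\<in>F g. \<forall>b\<in>F g. a \<ominus> b \<in> F g) \<and>
    (\<forall>g h. \<forall>a\<in>W g. \<forall>b\<in>F h. a \<otimes> b \<in> F (g + h))"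

definition graded_noetherian :: "('g::ab_group_add \<Rightarrow> 'a set) \<Rightarrow> bool"
  where "graded_noetherian W \<longleftrightarrow>
    (\<forall>F. (\<forall>n. graded_ideal W (F n)) \<and> (\<forall>n g. F n g \<subseteq> F (Suc n) g) \<longrightarrow> (\<exists>N. \<forall>n\<ge>N. F n = F N))"

lemma graded_subringD:
  assumes "graded_subring W"
  shows "a \<in> W g \<Longrightarrow> a \<in> carrier R" "\<zero> \<in> W g" "\<one> \<in> W 0"
    "\<lbrakk>a \<in> W g; b \<in> W g\<rbrakk> \<Longrightarrow> a \<ominus> b \<in> W g"
    "\<lbrakk>a \<in> W g; b \<in> W h\<rbrakk> \<Longrightarrow> a \<otimes> b \<in> W (g + h)"
  using assms unfolding graded_subring_def by blast+

lemma graded_idealD: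
  assumes "graded_ideal W F"
  shows "a \<in> F g \<Longrightarrow> a \<in> W g" "\<zero> \<in> F g"
    "\<lbrakk>a \<in> F g; b \<in> F g\<rbrakk> \<Longrightarrow> a \<ominus> b \<in> F g"
    "\<lbrakk>a \<in> W g; b \<in> F h\<rbrakk> \<Longrightarrow> a \<otimes> b \<in> F (g + h)"
  using assms unfolding graded_ideal_def by blast+

lemma add_mem_if_minus_mem:
  assumes "S \<subseteq> carrier R" "\<zero> \<in> S" "\<And>a b. \<lbrakk>a \<in> S; b \<in> S\<rbrakk> \<Longrightarrow> a \<ominus> b \<in> S" "a \<in> S" "b \<in> S"
  shows "a \<oplus> b \<in> S"
proof -
  have "a \<oplus> b = a \<ominus> (\<zero> \<ominus> b)" using assms by (simp add: a_minus_def subset_iff)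
  then show ?thesis using assms by metis
qed

lemma graded_subring_add: "\<lbrakk>graded_subring W; a \<in> W g; b \<in> W g\<rbrakk> \<Longrightarrow> a \<oplus> b \<in> W g"
  using add_mem_if_minus_mem[of "W g" a b] graded_subringD[of W] by blast

lemma graded_ideal_add: "\<lbrakk>graded_subring W; graded_ideal W F; a \<in> F g; b \<in> F g\<rbrakk> \<Longrightarrow> a \<oplus> b \<in> F g"
  using add_mem_if_minus_mem[of "F g" a b] graded_idealD[of W F] graded_subringD(1)[of W] by blast

lemma graded_noetherian_cofinal:
  assumes "graded_noetherian W" "\<And>n. graded_ideal W (F n)" "\<And>n g. F n g \<subseteq> F (Suc n) g"
  obtains N where "\<And>n. n \<ge> N \<Longrightarrow> F n = F N"
  using assms unfolding graded_noetherian_def by meson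

text \<open>The elements of degree \<open>g\<close> that are polynomials in \<open>x\<close>, placed
  in degree \<open>h\<close>, of degree below \<open>n\<close> in \<open>x\<close> and with
  coefficients in \<open>W\<close>. Values are taken in \<open>R\<close>, so the coefficients of an
  element need not be unique.\<close>

primrec adjoin_upto :: "('g::ab_group_add \<Rightarrow> 'a set) \<Rightarrow> 'a \<Rightarrow> 'g \<Rightarrow> nat \<Rightarrow> 'g \<Rightarrow> 'a set"
  where "adjoin_upto W x h 0 g = {\<zero>}"
  | "adjoin_upto W x h (Suc n) g =
      {x [^] n \<otimes> a \<oplus> v | a v. a \<in> W (g - nat_mult n h) \<and> v \<in> adjoin_upto W x h n g}"

definition adjoin :: "('g::ab_group_add \<Rightarrow> 'a set) \<Rightarrow> 'a \<Rightarrow> 'g \<Rightarrow> 'g \<Rightarrow> 'a set"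
  where "adjoin W x h g = (\<Union>n. adjoin_upto W x h n g)"

section \<open>Adjoining a homogeneous element: a graded Hilbert basis theorem\<close>

context
  fixes W :: "'g::ab_group_add \<Rightarrow> 'a set" and x :: 'a and h :: 'g
  assumes W: "graded_subring W" and x: "x \<in> carrier R"
begin

abbreviation "V \<equiv> adjoin_upto W x h"

lemmas WD = graded_subringD[OF W]

lemma adjoin_upto_carrier: "v \<in> V n g \<Longrightarrow> v \<in> carrier R"
  by (induction n arbitrary: v) (auto simp: x WD(1))

lemma adjoin_upto_SucI: "\<lbrakk>a \<in> W (g - nat_mult n h); v \<in> V n g\<rbrakk> \<Longrightarrow> x [^] n \<otimes> a \<oplus> v \<in> V (Suc n) g"
  by auto

lemma adjoin_upto_Suc_mono: "V n g \<subseteq> V (Suc n) g"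
proof
  fix v assume v: "v \<in> V n g"
  have "x [^] n \<otimes> \<zero> \<oplus> v \<in> V (Suc n) g" by (rule adjoin_upto_SucI[OF WD(2) v])
  then show "v \<in> V (Suc n) g" using adjoin_upto_carrier[OF v] x by simp
qed

lemma adjoin_upto_mono: "n \<le> m \<Longrightarrow> V n g \<subseteq> V m g"
  using adjoin_upto_Suc_mono by (rule lift_Suc_mono_le)

lemma adjoin_upto_zero: "\<zero> \<in> V n g"
  using adjoin_upto_mono[of 0 n g] by auto

lemma adjoin_upto_minus: "\<lbrakk>v \<in> V n g; w \<in> V n g\<rbrakk> \<Longrightarrow> v \<ominus> w \<in> V n g"
proof (induction n arbitrary: v w)
  case (Suc n)
  then obtain a v' b w' where *: "a \<in> W (g - nat_mult n h)" "v' \<in> V n g" "v = x [^] n \<otimes> a \<oplus> v'"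
      "b \<in> W (g - nat_mult n h)" "w' \<in> V n g" "w = x [^] n \<otimes> b \<oplus> w'"
    by auto
  have carr: "a \<in> carrier R" "b \<in> carrier R" "v' \<in> carrier R" "w' \<in> carrier R" "x [^] n \<in> carrier R"
    using * WD(1) adjoin_upto_carrier x by auto
  have "v \<ominus> w = x [^] n \<otimes> (a \<ominus> b) \<oplus> (v' \<ominus> w')"
    unfolding * using carr by algebra
  then show ?case using adjoin_upto_SucI[OF WD(4)[OF *(1,4)] Suc.IH[OF *(2,5)]] by metis
qed (simp add: a_minus_def)

lemma adjoin_upto_add: "\<lbrakk>v \<in> V n g; w \<in> V n g\<rbrakk> \<Longrightarrow> v \<oplus> w \<in> V n g"
  using add_mem_if_minus_mem[of "V n g" v w] adjoin_upto_carrier adjoin_upto_zero adjoin_upto_minus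
  by blast

lemma adjoin_upto_mult: "\<lbrakk>a \<in> W g'; v \<in> V n g\<rbrakk> \<Longrightarrow> a \<otimes> v \<in> V n (g' + g)"
proof (induction n arbitrary: v)
  case (Suc n)
  then obtain b w where *: "b \<in> W (g - nat_mult n h)" "w \<in> V n g" "v = x [^] n \<otimes> b \<oplus> w"
    by auto
  have carr: "a \<in> carrier R" "b \<in> carrier R" "w \<in> carrier R" "x [^] n \<in> carrier R"
    using * Suc WD(1) adjoin_upto_carrier x by auto
  have "a \<otimes> v = x [^] n \<otimes> (a \<otimes> b) \<oplus> a \<otimes> w"
    unfolding * using carr by algebra
  moreover have "a \<otimes> b \<in> W (g' + g - nat_mult n h)" using WD(5)[OF Suc.prems(1) *(1)] by (simp add: add_diff_eq)
  ultimately show ?case using adjoin_upto_SucI Suc.IH[OF Suc.prems(1) *(2)] by metis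
qed (simp add: WD(1))

lemma adjoin_upto_mult_gen: "v \<in> V n g \<Longrightarrow> x \<otimes> v \<in> V (Suc n) (g + h)"
proof (induction n arbitrary: v)
  case 0
  then show ?case using adjoin_upto_zero[of "Suc 0"] x by simp
next
  case (Suc n)
  then obtain b w where *: "b \<in> W (g - nat_mult n h)" "w \<in> V n g" "v = x [^] n \<otimes> b \<oplus> w"
    by auto
  have carr: "b \<in> carrier R" "w \<in> carrier R" "x [^] n \<in> carrier R"
    using * Suc WD(1) adjoin_upto_carrier x by auto
  have "x \<otimes> v = (x [^] n \<otimes> x) \<otimes> b \<oplus> x \<otimes> w"
    unfolding * using carr x by algebra
  then have "x \<otimes> v = x [^] Suc n \<otimes> b \<oplus> x \<otimes> w" by simp
  moreover have "b \<in> W (g + h - nat_mult (Suc n) h)" using *(1) by (simp add: algebra_simps)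
  ultimately show ?case using adjoin_upto_SucI Suc.IH[OF *(2)] by metis
qed

lemma adjoin_upto_mult_pow: "v \<in> V n g \<Longrightarrow> x [^] m \<otimes> v \<in> V (n + m) (g + nat_mult m h)"
proof (induction m)
  case 0
  then show ?case using adjoin_upto_carrier by simp
next
  case (Suc m)
  have "x [^] Suc m \<otimes> v = x \<otimes> (x [^] m \<otimes> v)"
    using x adjoin_upto_carrier[OF Suc.prems] by (simp add: m_ac)
  then show ?case using adjoin_upto_mult_gen[OF Suc.IH[OF Suc.prems]] by (simp add: add.assoc)
qed

lemma adjoin_iff: "v \<in> adjoin W x h g \<longleftrightarrow> (\<exists>n. v \<in> V n g)"
  by (auto simp: adjoin_def)

lemma adjoin_common:
  assumes "v \<in> adjoin W x h g" "w \<in> adjoin W x h g"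
  obtains n where "v \<in> V n g" "w \<in> V n g"
proof -
  obtain m n where "v \<in> V m g" "w \<in> V n g" using assms adjoin_iff by auto
  then have "v \<in> V (max m n) g" "w \<in> V (max m n) g"
    using adjoin_upto_mono[of m "max m n" g] adjoin_upto_mono[of n "max m n" g] by auto
  then show thesis by (rule that)
qed

lemma adjoin_upto_prod: "\<lbrakk>v \<in> V n g; w \<in> V m g'\<rbrakk> \<Longrightarrow> v \<otimes> w \<in> adjoin W x h (g + g')"
proof (induction n arbitrary: v)
  case 0
  then show ?case using adjoin_upto_zero adjoin_upto_carrier by (auto simp: adjoin_iff)
next
  case (Suc n)
  then obtain b u where *: "b \<in> W (g - nat_mult n h)" "u \<in> V n g" "v = x [^] n \<otimes> b \<oplus> u"
    by auto
  have carr: "b \<in> carrier R" "w \<in> carrier R" "u \<in> carrier R" "x [^] n \<in> carrier R"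
    using * Suc WD(1) adjoin_upto_carrier x by auto
  have "b \<otimes> w \<in> V m (g - nat_mult n h + g')"
    using adjoin_upto_mult[OF *(1) Suc.prems(2)] by simp
  from adjoin_upto_mult_pow[OF this, of n]
  have "x [^] n \<otimes> (b \<otimes> w) \<in> adjoin W x h (g + g')" by (auto simp: adjoin_iff algebra_simps)
  moreover have "u \<otimes> w \<in> adjoin W x h (g + g')" using Suc.IH[OF *(2) Suc.prems(2)] .
  ultimately obtain k where "x [^] n \<otimes> (b \<otimes> w) \<in> V k (g + g')" "u \<otimes> w \<in> V k (g + g')"
    by (rule adjoin_common)
  then have "x [^] n \<otimes> (b \<otimes> w) \<oplus> u \<otimes> w \<in> V k (g + g')" by (rule adjoin_upto_add)
  moreover have "v \<otimes> w = x [^] n \<otimes> (b \<otimes> w) \<oplus> u \<otimes> w"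
    unfolding * using carr by algebra
  ultimately show ?case by (auto simp: adjoin_iff)
qed

lemma subset_adjoin: "W g \<subseteq> adjoin W x h g"
proof
  fix a assume a: "a \<in> W g"
  have "x [^] (0::nat) \<otimes> a \<oplus> \<zero> \<in> V (Suc 0) g"
    by (rule adjoin_upto_SucI) (use a in auto)
  then have "a \<in> V (Suc 0) g" using WD(1)[OF a] by (simp del: adjoin_upto.simps)
  then show "a \<in> adjoin W x h g" unfolding adjoin_iff by blast
qed

lemma graded_subring_adjoin: "graded_subring (adjoin W x h)"
  unfolding graded_subring_def
proof (intro conjI allI ballI subsetI)
  fix g a b assume "a \<in> adjoin W x h g" "b \<in> adjoin W x h g"
  then show "a \<ominus> b \<in> adjoin W x h g"
    by (rule adjoin_common) (auto simp: adjoin_iff intro: adjoin_upto_minus)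
next
  fix g h' a b assume "a \<in> adjoin W x h g" "b \<in> adjoin W x h h'"
  then show "a \<otimes> b \<in> adjoin W x h (g + h')" using adjoin_iff adjoin_upto_prod by auto
next
  show "\<one> \<in> adjoin W x h 0" using subset_adjoin WD(3) by blast
qed (use adjoin_upto_carrier adjoin_upto_zero in \<open>auto simp: adjoin_iff\<close>)

lemma gen_mem_adjoin: "x \<in> adjoin W x h h"
proof -
  have "\<one> \<in> V (Suc 0) 0"
    using adjoin_upto_SucI[of \<one> 0 0 \<zero>] WD(3) by simp
  from adjoin_upto_mult_gen[OF this] have "x \<in> V (Suc (Suc 0)) h"
    using x by (simp del: adjoin_upto.simps)
  then show ?thesis unfolding adjoin_iff by blast
qed

lemma adjoin_least:
  assumes T: "graded_subring T" and "\<And>g. W g \<subseteq> T g" and "x \<in> T h"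
  shows "adjoin W x h g \<subseteq> T g"
proof -
  have pow: "x [^] n \<in> T (nat_mult n h)" for n
  proof (induction n)
    case (Suc n)
    then show ?case using graded_subringD(5)[OF T _ assms(3)] by simp
  qed (simp add: graded_subringD[OF T])
  have "v \<in> T g" if "v \<in> V n g" for n v
    using that
  proof (induction n arbitrary: v)
    case 0
    then show ?case using graded_subringD[OF T] by simp
  next
    case (Suc n)
    then obtain b u where *: "b \<in> W (g - nat_mult n h)" "u \<in> V n g" "v = x [^] n \<otimes> b \<oplus> u"
      by auto
    have "x [^] n \<otimes> b \<in> T (nat_mult n h + (g - nat_mult n h))"
      using graded_subringD(5)[OF T pow] * assms(2) by blast
    then show ?case using graded_subring_add[OF T] Suc.IH[OF *(2)] *(3) by simp
  qed
  then show ?thesis by (auto simp: adjoin_iff)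
qed

text \<open>The top coefficients from the proof of Hilbert's basis theorem, read off any expression
  of an element of \<open>F\<close>. The shift by \<open>nat_mult n h\<close> puts the coefficient
  itself into degree \<open>g\<close>.\<close>

definition leading :: "nat \<Rightarrow> ('g \<Rightarrow> 'a set) \<Rightarrow> 'g \<Rightarrow> 'a set"
  where "leading n F g = {a \<in> W g. \<exists>v\<in>V n (g + nat_mult n h). x [^] n \<otimes> a \<oplus> v \<in> F (g + nat_mult n h)}"

lemma graded_ideal_leading:
  assumes F: "graded_ideal (adjoin W x h) F"
  shows "graded_ideal W (leading n F)"
proof -
  note FD = graded_idealD[OF F]
  have xn: "x [^] n \<in> carrier R" using x by simp
  have "\<zero> \<in> leading n F g" for g
    unfolding leading_def using WD(2) adjoin_upto_zero[of n] FD(2) xn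
    by (auto intro!: bexI[of _ \<zero>])
  moreover have "a \<ominus> b \<in> leading n F g" if ab: "a \<in> leading n F g" "b \<in> leading n F g" for g a b
  proof -
    obtain v w where *: "a \<in> W g" "v \<in> V n (g + nat_mult n h)" "x [^] n \<otimes> a \<oplus> v \<in> F (g + nat_mult n h)"
        "b \<in> W g" "w \<in> V n (g + nat_mult n h)" "x [^] n \<otimes> b \<oplus> w \<in> F (g + nat_mult n h)"
      using ab unfolding leading_def by blast
    have carr: "a \<in> carrier R" "b \<in> carrier R" "v \<in> carrier R" "w \<in> carrier R"
      using * WD(1) adjoin_upto_carrier by auto
    have "x [^] n \<otimes> (a \<ominus> b) \<oplus> (v \<ominus> w) = (x [^] n \<otimes> a \<oplus> v) \<ominus> (x [^] n \<otimes> b \<oplus> w)"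
      using carr xn by algebra
    then show ?thesis unfolding leading_def
      using WD(4)[OF *(1,4)] adjoin_upto_minus[OF *(2,5)] FD(3)[OF *(3,6)]
      by (intro CollectI conjI bexI[of _ "v \<ominus> w"]) auto
  qed
  moreover have "a \<otimes> b \<in> leading n F (g + g')" if ab: "a \<in> W g" "b \<in> leading n F g'" for g g' a b
  proof -
    obtain w where *: "b \<in> W g'" "w \<in> V n (g' + nat_mult n h)" "x [^] n \<otimes> b \<oplus> w \<in> F (g' + nat_mult n h)"
      using ab(2) unfolding leading_def by auto
    have carr: "a \<in> carrier R" "b \<in> carrier R" "w \<in> carrier R"
      using * ab WD(1) adjoin_upto_carrier by auto
    have "x [^] n \<otimes> (a \<otimes> b) \<oplus> a \<otimes> w = a \<otimes> (x [^] n \<otimes> b \<oplus> w)"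
      using carr xn by algebra
    moreover have "a \<otimes> (x [^] n \<otimes> b \<oplus> w) \<in> F (g + (g' + nat_mult n h))"
      using FD(4) *(3) ab(1) subset_adjoin by blast
    ultimately show ?thesis unfolding leading_def
      using WD(5)[OF ab(1) *(1)] adjoin_upto_mult[OF ab(1) *(2)]
      by (intro CollectI conjI bexI[of _ "a \<otimes> w"]) (simp_all add: add.assoc)
  qed
  moreover have "leading n F g \<subseteq> W g" for g by (auto simp: leading_def)
  ultimately show ?thesis unfolding graded_ideal_def by simp
qed

text \<open>Multiplying by \<open>x\<close> raises the exponent of the top term and keeps its
  coefficient.\<close>

lemma leading_Suc_mono:
  assumes F: "graded_ideal (adjoin W x h) F"
  shows "leading n F g \<subseteq> leading (Suc n) F g"
proof
  fix a assume "a \<in> leading n F g"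
  then obtain v where *: "a \<in> W g" "v \<in> V n (g + nat_mult n h)" "x [^] n \<otimes> a \<oplus> v \<in> F (g + nat_mult n h)"
    unfolding leading_def by blast
  have carr: "a \<in> carrier R" "v \<in> carrier R" "x [^] n \<in> carrier R" using * WD(1) adjoin_upto_carrier x by auto
  have "x \<otimes> (x [^] n \<otimes> a \<oplus> v) \<in> F (h + (g + nat_mult n h))"
    using graded_idealD(4)[OF F gen_mem_adjoin *(3)] .
  moreover have "x \<otimes> (x [^] n \<otimes> a \<oplus> v) = (x [^] n \<otimes> x) \<otimes> a \<oplus> x \<otimes> v"
    using carr x by algebra
  ultimately have "x [^] Suc n \<otimes> a \<oplus> x \<otimes> v \<in> F (g + nat_mult (Suc n) h)"
    by (simp add: algebra_simps)
  moreover have "x \<otimes> v \<in> V (Suc n) (g + nat_mult (Suc n) h)"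
    using adjoin_upto_mult_gen[OF *(2)] by (simp add: algebra_simps)
  ultimately show "a \<in> leading (Suc n) F g" unfolding leading_def using * by blast
qed

text \<open>Induction on the number of terms: subtracting from \<open>f\<close> an element of
  \<open>F g\<close> with the same top coefficient leaves an element of \<open>F' g\<close> with one
  term fewer.\<close>

lemma subset_if_leading_subset:
  assumes F: "graded_ideal (adjoin W x h) F" and F': "graded_ideal (adjoin W x h) F'"
    and sub: "\<And>g. F g \<subseteq> F' g" and lead: "\<And>n g. leading n F' g \<subseteq> leading n F g"
  shows "F' g \<subseteq> F g"
proof -
  have "f \<in> F g" if "f \<in> V n g" "f \<in> F' g" for n f
    using that
  proof (induction n arbitrary: f)
    case 0
    then show ?case using graded_idealD(2)[OF F] by simp
  next
    case (Suc n)
    then obtain a v where *: "a \<in> W (g - nat_mult n h)" "v \<in> V n g" "f = x [^] n \<otimes> a \<oplus> v"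
      by auto
    then have "a \<in> leading n F' (g - nat_mult n h)" using Suc.prems unfolding leading_def by auto
    then have "a \<in> leading n F (g - nat_mult n h)" using lead by blast
    then obtain w where w: "w \<in> V n g" "x [^] n \<otimes> a \<oplus> w \<in> F g" unfolding leading_def by auto
    have carr: "a \<in> carrier R" "v \<in> carrier R" "w \<in> carrier R" "x [^] n \<in> carrier R"
      using * w WD(1) adjoin_upto_carrier x by auto
    have "v \<ominus> w = f \<ominus> (x [^] n \<otimes> a \<oplus> w)"
      unfolding * using carr by algebra
    then have "v \<ominus> w \<in> F' g" using graded_idealD(3)[OF F' Suc.prems(2)] w sub by auto
    then have "v \<ominus> w \<in> F g" using Suc.IH adjoin_upto_minus[OF *(2) w(1)] by blast
    moreover have "f = (v \<ominus> w) \<oplus> (x [^] n \<otimes> a \<oplus> w)"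
      unfolding * using carr by algebra
    ultimately show ?case using graded_ideal_add[OF graded_subring_adjoin F] w by metis
  qed
  then show ?thesis using graded_idealD(1)[OF F'] adjoin_iff by blast
qed

text \<open>Hilbert's argument for the family \<open>leading k (F n)\<close>, which increases in
  \<open>k\<close> and in \<open>n\<close>: its diagonal is constant from some \<open>N\<close> on,
  and each of the finitely many sequences with fixed \<open>k \<le> N\<close> becomes constant, so
  one index \<open>B\<close> serves all \<open>k\<close>.\<close>

lemma graded_noetherian_adjoin:
  assumes noeth: "graded_noetherian W"
  shows "graded_noetherian (adjoin W x h)"
  unfolding graded_noetherian_def
proof (intro allI impI, elim conjE)
  fix F :: "nat \<Rightarrow> 'g \<Rightarrow> 'a set"
  assume "\<forall>n. graded_ideal (adjoin W x h) (F n)" and "\<forall>n g. F n g \<subseteq> F (Suc n) g"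
  then have F: "\<And>n. graded_ideal (adjoin W x h) (F n)" and F_Suc: "\<And>n g. F n g \<subseteq> F (Suc n) g"
    by auto
  have F_mono: "F m g \<subseteq> F n g" if "m \<le> n" for m n g
    using F_Suc that by (rule lift_Suc_mono_le)
  have lF: "leading k (F m) g \<subseteq> leading k (F n) g" if "m \<le> n" for k m n g
    using F_mono[OF that] unfolding leading_def by blast
  have lS: "leading k (F m) g \<subseteq> leading l (F m) g" if "k \<le> l" for k l m g
    using leading_Suc_mono[OF F] that by (rule lift_Suc_mono_le)
  have "leading n (F n) g \<subseteq> leading (Suc n) (F (Suc n)) g" for n g
    using lF[of n "Suc n" n g] leading_Suc_mono[OF F, of n "Suc n" g] by auto
  then obtain N where N: "\<And>n. n \<ge> N \<Longrightarrow> leading n (F n) = leading N (F N)"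
    using graded_noetherian_cofinal[OF noeth, of "\<lambda>n. leading n (F n)"] graded_ideal_leading[OF F]
    by metis
  have "leading k (F n) g \<subseteq> leading k (F (Suc n)) g" for k n g
    using lF[of n "Suc n" k g] by simp
  then have "\<exists>M. \<forall>n\<ge>M. leading k (F n) = leading k (F M)" for k
    using graded_noetherian_cofinal[OF noeth, of "\<lambda>n. leading k (F n)"] graded_ideal_leading[OF F]
    by metis
  then obtain M where M: "\<And>k n. n \<ge> M k \<Longrightarrow> leading k (F n) = leading k (F (M k))" by metis
  define B where "B = Max (insert N (M ` {..N}))"
  have B: "N \<le> B" "\<And>k. k \<le> N \<Longrightarrow> M k \<le> B"
    unfolding B_def by (auto intro!: Max_ge simp del: Max_insert)
  have "F n = F B" if n: "n \<ge> B" for n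
  proof
    fix g
    have "leading k (F n) g' \<subseteq> leading k (F B) g'" for k g'
    proof (cases "k \<le> N")
      case True
      then show ?thesis using M[of k n] M[of k B] B(2)[of k] n by auto
    next
      case False
      \<comment> \<open>Beyond \<open>N\<close> the diagonal takes over: with both indices raised to
        \<open>max k n\<close> the value is \<open>leading N (F N)\<close>, which already lies in
        \<open>leading k (F B)\<close>.\<close>
      have "leading k (F n) g' \<subseteq> leading (max k n) (F (max k n)) g'"
        using lF[of n "max k n"] lS[of k "max k n"] by (meson max.cobounded1 max.cobounded2 order_trans)
      also have "\<dots> = leading N (F N) g'" using N[of "max k n"] False by auto
      also have "\<dots> \<subseteq> leading k (F B) g'" using lF[OF B(1), of N] lS[of N k B] False by force
      finally show ?thesis .
    qed
    then show "F n g = F B g"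
      using subset_if_leading_subset[OF F F, of B n] F_mono[OF n] by blast
  qed
  then show "\<exists>N. \<forall>n\<ge>N. F n = F N" by blast
qed

end

end

lemma (in noetherian_ring) ascending_ideals_stable:
  fixes I :: "nat \<Rightarrow> 'a set"
  assumes "\<And>n. ideal (I n) R" "\<And>n. I n \<subseteq> I (Suc n)"
  obtains N where "\<And>n. n \<ge> N \<Longrightarrow> I n = I N"
proof -
  have mono: "I m \<subseteq> I n" if "m \<le> n" for m n using assms(2) that by (rule lift_Suc_mono_le)
  have "subset.chain {I. ideal I R} (range I)"
    unfolding subset_chain_def using assms(1) by (auto, metis mono nat_le_linear subsetD)
  then have "\<Union>(range I) \<in> range I" using ideal_chain_is_trivial by blast
  then obtain N where N: "\<Union>(range I) = I N" by auto
  then have "I n = I N" if "n \<ge> N" for n using mono[OF that] by blast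
  then show thesis by (rule that)
qed

locale noetherian_cring = noetherian_ring + cring

section \<open>A uniform Artin-Rees theorem\<close>

context cring
begin

lemma comm_monoid_ideals_set: "comm_monoid (ideals_set R)"
proof -
  interpret S: semiring "ideals_set R" by (rule ideals_set_is_semiring)
  show ?thesis
    by unfold_locales (auto simp: ideals_set_def ideal_prod_commute)
qed

text \<open>Makes the laws of powers in commutative monoids available for powers of ideals.\<close>

sublocale ideals: comm_monoid "ideals_set R"
  rewrites "carrier (ideals_set R) = {I. ideal I R}"
    and "mult (ideals_set R) = ideal_prod R"
    and "one (ideals_set R) = carrier R"
  by (rule comm_monoid_ideals_set) (simp_all add: ideals_set_def)

lemma mult_ideals_set [simp]: "mult (ideals_set R) = ideal_prod R"
  by (simp add: ideals_set_def)

lemma one_ideals_set [simp]: "one (ideals_set R) = carrier R"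
  by (simp add: ideals_set_def)

abbreviation ideal_power :: "'a set \<Rightarrow> nat \<Rightarrow> 'a set" (infixr \<open>\<up>\<close> 85)
  where "I \<up> n \<equiv> I [^]\<^bsub>ideals_set R\<^esub> n"



lemma ideal_prod_mono:
  assumes "I \<subseteq> I'" "J \<subseteq> J'"
  shows "I \<cdot> J \<subseteq> I' \<cdot> J'"
proof
  fix x assume "x \<in> I \<cdot> J"
  then show "x \<in> I' \<cdot> J'"
    by (induction x rule: ideal_prod.induct) (use assms in \<open>auto intro: ideal_prod.intros\<close>)
qed

lemma ideal_prod_least:
  assumes "ideal K R" "\<And>i j. \<lbrakk>i \<in> I; j \<in> J\<rbrakk> \<Longrightarrow> i \<otimes> j \<in> K"
  shows "I \<cdot> J \<subseteq> K"
proof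
  fix x assume "x \<in> I \<cdot> J"
  then show "x \<in> K"
    by (induction x rule: ideal_prod.induct) (auto intro: assms ideal_add_mem[OF assms(1)])
qed

lemma ideal_ideal_power: "ideal I R \<Longrightarrow> ideal (I \<up> n) R"
  using ideals.nat_pow_closed by simp

lemma ideal_power_mono: "I \<subseteq> J \<Longrightarrow> I \<up> n \<subseteq> J \<up> n"
proof (induction n)
  case (Suc n)
  then show ?case using ideal_prod_mono[of "I \<up> n" "J \<up> n" I J] by simp
qed simp

lemma ideal_power_antimono: "\<lbrakk>ideal I R; m \<le> n\<rbrakk> \<Longrightarrow> I \<up> n \<subseteq> I \<up> m"
proof (rule lift_Suc_antimono_le[of "\<lambda>n. I \<up> n"])
  fix n assume "ideal I R"
  then show "I \<up> Suc n \<subseteq> I \<up> n"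
    using ideal_prod_inter[of "I \<up> n" I] ideal_ideal_power[of I n] by auto
qed

text \<open>The component of degree \<open>(k, i)\<close> of the Rees algebra
  \<open>R[M T, J U]\<close> in two variables \<open>T\<close> and \<open>U\<close>. Degrees have to
  form a group, so the components with a negative index are set to zero.\<close>

definition rees :: "'a set \<Rightarrow> 'a set \<Rightarrow> int \<times> int \<Rightarrow> 'a set"
  where "rees M J = (\<lambda>(k, i). if k \<ge> 0 \<and> i \<ge> 0 then M \<up> nat k \<cdot> J \<up> nat i else {\<zero>})"

lemma rees_nat: "rees M J (int k, int i) = M \<up> k \<cdot> J \<up> i"
  by (simp add: rees_def)

lemma ideal_rees: "\<lbrakk>ideal M R; ideal J R\<rbrakk> \<Longrightarrow> ideal (rees M J g) R"
  by (cases g) (simp add: rees_def ideal_prod_is_ideal ideal_ideal_power zeroideal del: pow_nat)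

lemma ideal_power_prod:
  assumes "ideal M R" "ideal J R"
  shows "(M \<up> k \<cdot> J \<up> i) \<cdot> (M \<up> k' \<cdot> J \<up> i') = M \<up> (k + k') \<cdot> J \<up> (i + i')"
  using assms by (simp add: ideals.nat_pow_mult[symmetric] ideals.m_ac ideal_ideal_power ideal_prod_is_ideal)

lemma graded_subring_rees:
  assumes M: "ideal M R" and J: "ideal J R"
  shows "graded_subring (rees M J)"
  unfolding graded_subring_def
proof (intro conjI allI ballI)
  note id = ideal_rees[OF M J]
  fix g h a b
  show "rees M J g \<subseteq> carrier R" "\<zero> \<in> rees M J g"
    using id ideal_subset_carrier ideal_zero_mem by auto
  show "\<one> \<in> rees M J 0"
    using oneideal by (simp add: rees_def zero_prod_def ideal_prod_one)
  assume a: "a \<in> rees M J g"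
  show "a \<ominus> b \<in> rees M J g" if "b \<in> rees M J g" using id ideal_minus_mem a that by blast
  show "a \<otimes> b \<in> rees M J (g + h)" if b: "b \<in> rees M J h"
  proof (cases "fst g \<ge> 0 \<and> snd g \<ge> 0 \<and> fst h \<ge> 0 \<and> snd h \<ge> 0")
    case True
    then obtain k i k' i' where "g = (int k, int i)" "h = (int k', int i')"
      by (metis nonneg_int_cases prod.collapse)
    then show ?thesis
      using a b ideal_prod.prod[of a "rees M J g" b "rees M J h" R] ideal_power_prod[OF M J, of k i k' i']
        rees_nat[of M J "k + k'" "i + i'"]
      by (simp add: rees_nat)
  next
    case False
    then have "a = \<zero> \<or> b = \<zero>" using a b by (cases g; cases h) (auto simp: rees_def split: if_splits)
    then have "a \<otimes> b = \<zero>"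
      using a b id[THEN ideal_subset_carrier, of g] id[THEN ideal_subset_carrier, of h] by auto
    then show ?thesis using id ideal_zero_mem by auto
  qed
qed

end

section \<open>Noetherianity of the Rees algebra and the Artin-Rees inclusions\<close>

context noetherian_cring
begin

lemma graded_noetherian_base: "graded_noetherian (\<lambda>g::'g::ab_group_add. if g = 0 then carrier R else {\<zero>})"
  (is "graded_noetherian ?W")
  unfolding graded_noetherian_def
proof (intro allI impI, elim conjE)
  fix F :: "nat \<Rightarrow> 'g \<Rightarrow> 'a set"
  assume F: "\<forall>n. graded_ideal ?W (F n)" and mono: "\<forall>n g. F n g \<subseteq> F (Suc n) g"
  have W: "graded_subring ?W" unfolding graded_subring_def by (auto simp: a_minus_def)
  have "ideal (F n 0) R" for n
  proof (rule idealI_comm)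
    have Fn: "graded_ideal ?W (F n)" using F by blast
    note FD = graded_idealD[OF Fn]
    show "F n 0 \<subseteq> carrier R" using FD(1)[of _ 0] by auto
    show "\<zero> \<in> F n 0" by (rule FD(2))
    show "a \<oplus> b \<in> F n 0" if "a \<in> F n 0" "b \<in> F n 0" for a b
      using graded_ideal_add[OF W Fn that] .
    show "r \<otimes> a \<in> F n 0" if "r \<in> carrier R" "a \<in> F n 0" for r a
      using FD(4)[of r 0 a 0] that by simp
  qed
  then obtain N where N: "\<And>n. n \<ge> N \<Longrightarrow> F n 0 = F N 0"
    using ascending_ideals_stable[of "\<lambda>n. F n 0"] mono by blast
  have "F n g = {\<zero>}" if "g \<noteq> 0" for n g
    using that graded_idealD(1,2)[OF F[rule_format, of n]] by fastforce
  then have "F n = F N" if "n \<ge> N" for n using N[OF that] by (metis ext)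
  then show "\<exists>N. \<forall>n\<ge>N. F n = F N" by blast
qed

text \<open>Adjoins the listed elements one by one, starting from \<open>R\<close> placed in degree
  0. The bound by \<open>T\<close> is what later allows the result to be identified with the Rees
  algebra.\<close>

lemma graded_noetherian_generated:
  assumes T: "graded_subring T" "carrier R \<subseteq> T 0" and "\<And>y g. (y, g) \<in> set ys \<Longrightarrow> y \<in> T g"
  shows "\<exists>W. graded_subring W \<and> graded_noetherian W \<and> carrier R \<subseteq> W 0 \<and> (\<forall>g. W g \<subseteq> T g) \<and>
    (\<forall>(y, g) \<in> set ys. y \<in> W g)"
  using assms(3)
proof (induction ys)
  case Nil
  let ?W = "\<lambda>g. if g = 0 then carrier R else {\<zero>}"
  have "graded_subring ?W" unfolding graded_subring_def by (auto simp: a_minus_def)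
  then show ?case
    using graded_noetherian_base T graded_subringD(2)[OF T(1)] by (intro exI[of _ ?W]) auto
next
  case (Cons yg ys)
  obtain y h where yh: "yg = (y, h)" by (cases yg)
  obtain W where W: "graded_subring W" "graded_noetherian W" "carrier R \<subseteq> W 0" "\<And>g. W g \<subseteq> T g"
      "\<forall>(y, g) \<in> set ys. y \<in> W g"
    using Cons by force
  have y: "y \<in> T h" "y \<in> carrier R" using Cons.prems[of y h] graded_subringD(1)[OF T(1)] yh by auto
  show ?case
    using graded_subring_adjoin[OF W(1) y(2)] graded_noetherian_adjoin[OF W(1) y(2) W(2)]
      subset_adjoin[OF W(1) y(2)] adjoin_least[OF W(1) y(2) T(1) W(4) y(1)] gen_mem_adjoin[OF W(1) y(2), of h]
      W(3,5) yh
    by (intro exI[of _ "adjoin W y h"]) fastforce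
qed

text \<open>The subring \<open>W\<close> generated over \<open>R\<close> by generators of
  \<open>M\<close> in degree \<open>(1, 0)\<close> and of \<open>J\<close> in degree
  \<open>(0, 1)\<close> contains \<open>M\<close> and \<open>J\<close> in these degrees, hence all
  products \<open>M \<up> k \<cdot> J \<up> i\<close>, so it is the whole algebra.\<close>

lemma graded_noetherian_rees:
  assumes M: "ideal M R" and J: "ideal J R"
  shows "graded_noetherian (rees M J)"
proof -
  obtain A B where A: "A \<subseteq> carrier R" "finite A" "M = Idl A" and B: "B \<subseteq> carrier R" "finite B" "J = Idl B"
    using finetely_gen[OF M] finetely_gen[OF J] by blast
  obtain as bs where as: "set as = A" and bs: "set bs = B" using A B finite_list by metis
  define ys where "ys = map (\<lambda>a. (a, (1::int, 0::int))) as @ map (\<lambda>b. (b, (0, 1))) bs"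
  note T = graded_subring_rees[OF M J]
  have AM: "A \<subseteq> M" "B \<subseteq> J" using genideal_self A B by auto
  have T10: "rees M J (1, 0) = M" "rees M J (0, 1) = J" "rees M J 0 = carrier R"
    using M J oneideal
    by (simp_all add: rees_def zero_prod_def ideal_prod_one ideals.l_one)
  have mem: "y \<in> rees M J g" if "(y, g) \<in> set ys" for y g
    using that as bs AM T10 by (auto simp: ys_def)
  have "carrier R \<subseteq> rees M J 0" by (simp add: T10)
  from graded_noetherian_generated[OF T this mem] obtain W
    where W: "graded_subring W" "graded_noetherian W" "carrier R \<subseteq> W 0" "\<And>g. W g \<subseteq> rees M J g"
      "\<forall>(y, g) \<in> set ys. y \<in> W g" by blast
  note WD = graded_subringD[OF W(1)]
  have idW: "ideal (W g) R" for g
  proof (rule idealI_comm)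
    show "r \<otimes> a \<in> W g" if "r \<in> carrier R" "a \<in> W g" for r a
      using WD(5)[of r 0 a g] that W(3) by auto
  qed (use WD(1,2) graded_subring_add[OF W(1)] in blast)+
  have "A \<subseteq> W (1, 0)" "B \<subseteq> W (0, 1)" using W(5) as bs by (auto simp: ys_def)
  then have "M \<subseteq> W (1, 0)" "J \<subseteq> W (0, 1)"
    unfolding A(3) B(3) using genideal_minimal[OF idW] by blast+
  have Wprod: "I \<cdot> I' \<subseteq> W (g + h)" if "I \<subseteq> W g" "I' \<subseteq> W h" for I I' g h
    using WD(5) that by (intro ideal_prod_least idW) blast
  have MW: "M \<up> k \<subseteq> W (int k, 0)" for k
  proof (induction k)
    case (Suc k)
    then show ?case
      using Wprod[OF Suc \<open>M \<subseteq> W (1, 0)\<close>] by (simp add: add.commute)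
  qed (use W(3) in \<open>simp add: zero_prod_def\<close>)
  have JW: "J \<up> k \<subseteq> W (0, int k)" for k
  proof (induction k)
    case (Suc k)
    then show ?case
      using Wprod[OF Suc \<open>J \<subseteq> W (0, 1)\<close>] by (simp add: add.commute)
  qed (use W(3) in \<open>simp add: zero_prod_def\<close>)
  have "rees M J g \<subseteq> W g" for g
  proof (cases "fst g \<ge> 0 \<and> snd g \<ge> 0")
    case True
    then obtain k i where "g = (int k, int i)" by (metis nonneg_int_cases prod.collapse)
    then show ?thesis using Wprod[OF MW[of k] JW[of i]] by (simp add: rees_nat)
  next
    case False
    then show ?thesis using WD(2)[of g] by (cases g) (auto simp: rees_def)
  qed
  then have "rees M J = W" using W(4) by blast
  then show ?thesis using W(2) by simp
qed

text \<open>The homogeneous ideals \<open>F e\<close> grow with \<open>e\<close> and become constant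
  at some \<open>N\<close>. The constant is uniform because \<open>N\<close> works for all degrees
  \<open>(k, i)\<close> at once.\<close>

theorem artin_rees:
  assumes M: "ideal M R" and J: "ideal J R" and P: "ideal P R"
  shows "\<exists>e. \<forall>k i. M \<up> (k + e) \<cdot> J \<up> i \<inter> (J \<up> Suc i <+>\<^bsub>R\<^esub> P) \<subseteq> M \<up> k \<cdot> J \<up> Suc i <+>\<^bsub>R\<^esub> P"
proof -
  define G where "G e k i = M \<up> k \<cdot> J \<up> i \<inter> (M \<up> (k - e) \<cdot> J \<up> Suc i <+>\<^bsub>R\<^esub> P)" for e k i
  define F where "F e = (\<lambda>(k::int, i::int). if k \<ge> 0 \<and> i \<ge> 0 then G e (nat k) (nat i) else {\<zero>})" for e
  note ids = ideal_ideal_power[OF M] ideal_ideal_power[OF J]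
  have idsum: "ideal (M \<up> k \<cdot> J \<up> i <+>\<^bsub>R\<^esub> P) R" for k i
    using ids P by (intro add_ideals ideal_prod_is_ideal)
  have idG: "ideal (G e k i) R" for e k i
    unfolding G_def using ids idsum by (intro i_intersect ideal_prod_is_ideal)
  have idF: "ideal (F e g) R" for e g
    using idG zeroideal by (cases g) (simp add: F_def)
  have Fsub: "F e g \<subseteq> rees M J g" for e g by (cases g) (auto simp: F_def G_def rees_def)
  have Gmult: "a \<otimes> b \<in> G e (k + k') (i + i')" if a: "a \<in> M \<up> k \<cdot> J \<up> i" and b: "b \<in> G e k' i'"
    for e k i k' i' a b
  proof -
    have ac: "a \<in> carrier R" using a ideal_prod_in_carrier ids by blast
    obtain c q where c: "c \<in> M \<up> (k' - e) \<cdot> J \<up> Suc i'" "q \<in> P" "b = c \<oplus> q"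
      using b set_add_iff[of b "M \<up> (k' - e) \<cdot> J \<up> Suc i'" P] unfolding G_def by blast
    have cc: "c \<in> carrier R" "q \<in> carrier R" using c ideal_prod_in_carrier ids P ideal_subset_carrier by blast+
    have "a \<otimes> c \<in> (M \<up> k \<cdot> J \<up> i) \<cdot> (M \<up> (k' - e) \<cdot> J \<up> Suc i')" using a c by (intro ideal_prod.prod)
    also have "\<dots> = M \<up> (k + (k' - e)) \<cdot> J \<up> (i + Suc i')" by (rule ideal_power_prod[OF M J])
    \<comment> \<open>Subtraction is truncated, but \<open>k + k' - e \<le> k + (k' - e)\<close>
      always holds, and the smaller exponent gives the larger ideal.\<close>
    also have "\<dots> \<subseteq> M \<up> (k + k' - e) \<cdot> J \<up> Suc (i + i')"
      using ideal_power_antimono[OF M, of "k + k' - e" "k + (k' - e)"] by (intro ideal_prod_mono) auto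
    finally have "a \<otimes> c \<oplus> a \<otimes> q \<in> M \<up> (k + k' - e) \<cdot> J \<up> Suc (i + i') <+>\<^bsub>R\<^esub> P"
      using ideal.I_l_closed[OF P c(2) ac] unfolding set_add_iff by blast
    moreover have "a \<otimes> b = a \<otimes> c \<oplus> a \<otimes> q" using c ac cc by (simp add: r_distr)
    moreover have "a \<otimes> b \<in> (M \<up> k \<cdot> J \<up> i) \<cdot> (M \<up> k' \<cdot> J \<up> i')"
      using a b unfolding G_def by (intro ideal_prod.prod) auto
    ultimately show ?thesis unfolding G_def using ideal_power_prod[OF M J, of k i k' i'] by simp
  qed
  have "graded_ideal (rees M J) (F e)" for e
    unfolding graded_ideal_def
  proof (intro conjI allI ballI)
    fix g h a b
    show "F e g \<subseteq> rees M J g" "\<zero> \<in> F e g" using Fsub idF ideal_zero_mem by auto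
    show "a \<ominus> b \<in> F e g" if "a \<in> F e g" "b \<in> F e g" using idF ideal_minus_mem that by blast
    show "a \<otimes> b \<in> F e (g + h)" if a: "a \<in> rees M J g" and b: "b \<in> F e h"
    proof (cases "fst g \<ge> 0 \<and> snd g \<ge> 0 \<and> fst h \<ge> 0 \<and> snd h \<ge> 0")
      case True
      then obtain k i k' i' where gh: "g = (int k, int i)" "h = (int k', int i')"
        by (metis nonneg_int_cases prod.collapse)
      then have "a \<in> M \<up> k \<cdot> J \<up> i" "b \<in> G e k' i'" using a b by (auto simp: rees_nat F_def)
      from Gmult[OF this] show ?thesis by (simp add: gh F_def nat_add_distrib)
    next
      case False
      then have "a = \<zero> \<or> b = \<zero>"
        using a b by (cases g; cases h) (auto simp: rees_def F_def split: if_splits)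
      moreover have "a \<in> carrier R" "b \<in> carrier R"
        using a b ideal_rees[OF M J, of g] idF[of e h] ideal.Icarr by metis+
      ultimately have "a \<otimes> b = \<zero>" by auto
      then show ?thesis using idF ideal_zero_mem by auto
    qed
  qed
  moreover have "F e g \<subseteq> F (Suc e) g" for e g
  proof -
    have "G e k i \<subseteq> G (Suc e) k i" for k i
      unfolding G_def using ideal_power_antimono[OF M, of "k - Suc e" "k - e"]
      by (intro Int_mono set_add_mono ideal_prod_mono) auto
    then show ?thesis by (cases g) (simp add: F_def)
  qed
  ultimately obtain N where N: "\<And>n. n \<ge> N \<Longrightarrow> F n = F N"
    using graded_noetherian_cofinal[OF graded_noetherian_rees[OF M J], of F] by blast
  have "M \<up> (k + N) \<cdot> J \<up> i \<inter> (J \<up> Suc i <+>\<^bsub>R\<^esub> P) \<subseteq> M \<up> k \<cdot> J \<up> Suc i <+>\<^bsub>R\<^esub> P" for k i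
  proof -
    \<comment> \<open>In degree \<open>k + N\<close> the index \<open>k + N\<close> leaves the power
      \<open>M \<up> 0\<close>, while the index \<open>N\<close> leaves exactly
      \<open>M \<up> k\<close>.\<close>
    have "M \<up> (k + N) \<cdot> J \<up> i \<inter> (J \<up> Suc i <+>\<^bsub>R\<^esub> P) = G (k + N) (k + N) i"
      unfolding G_def using ids(2)[of "Suc i"]
      by (simp add: ideals.l_one del: nat_pow_Suc)
    also have "\<dots> = F (k + N) (int (k + N), int i)" by (simp add: F_def nat_int_add del: of_nat_add)
    also have "\<dots> = F N (int (k + N), int i)" using N[of "k + N"] by simp
    also have "\<dots> \<subseteq> M \<up> k \<cdot> J \<up> Suc i <+>\<^bsub>R\<^esub> P"
      by (simp add: F_def G_def nat_int_add del: of_nat_add)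
    finally show ?thesis .
  qed
  then show ?thesis by blast
qed

text \<open>Uses \<open>artin_rees\<close> \<open>i\<close> times, each time trading
  \<open>e\<close> powers of \<open>M\<close> for one factor \<open>J\<close>. As the same
  \<open>e\<close> serves for every power of \<open>J\<close>, the total loss is linear in
  \<open>i\<close>.\<close>

lemma uniform_artin_rees:
  assumes M: "ideal M R" and J: "ideal J R" and P: "ideal P R"
  shows "\<exists>e. \<forall>k i. (M \<up> (k + e * i) <+>\<^bsub>R\<^esub> P) \<inter> (J \<up> i <+>\<^bsub>R\<^esub> P) \<subseteq> M \<up> k \<cdot> J \<up> i <+>\<^bsub>R\<^esub> P"
proof -
  obtain e where e: "\<And>k i. M \<up> (k + e) \<cdot> J \<up> i \<inter> (J \<up> Suc i <+>\<^bsub>R\<^esub> P) \<subseteq> M \<up> k \<cdot> J \<up> Suc i <+>\<^bsub>R\<^esub> P"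
    using artin_rees[OF assms] by blast
  note ids = ideal_ideal_power[OF M] ideal_ideal_power[OF J]
  have "x \<in> M \<up> (k + e * (i - j)) \<cdot> J \<up> j <+>\<^bsub>R\<^esub> P"
    if x: "x \<in> M \<up> (k + e * i) <+>\<^bsub>R\<^esub> P" "x \<in> J \<up> i <+>\<^bsub>R\<^esub> P" and "j \<le> i" for x k i j
    using \<open>j \<le> i\<close>
  proof (induction j)
    case 0
    then show ?case using x ids(1) by (simp add: ideal_prod_one)
  next
    case (Suc j)
    then have "x \<in> M \<up> (k + e * (i - j)) \<cdot> J \<up> j <+>\<^bsub>R\<^esub> P" by simp
    \<comment> \<open>\<open>artin_rees\<close> speaks of elements of the product ideal itself, so
      the part \<open>q\<close> in \<open>P\<close> is split off here and restored at the
      end.\<close>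
    then obtain y q where y: "y \<in> M \<up> (k + e * (i - j)) \<cdot> J \<up> j" "q \<in> P" "x = y \<oplus> q"
      unfolding set_add_iff by blast
    have carr: "y \<in> carrier R" "q \<in> carrier R"
      using y ideal_prod_in_carrier ids P ideal_subset_carrier by blast+
    have J': "ideal (J \<up> Suc j <+>\<^bsub>R\<^esub> P) R" using ids P add_ideals by blast
    have "x \<in> J \<up> Suc j <+>\<^bsub>R\<^esub> P"
      using x(2) set_add_mono[OF ideal_power_antimono[OF J Suc.prems] subset_refl[of P]] by blast
    moreover have "q \<in> J \<up> Suc j <+>\<^bsub>R\<^esub> P" using subset_set_add(2)[OF ids(2) P] y by blast
    ultimately have "x \<ominus> q \<in> J \<up> Suc j <+>\<^bsub>R\<^esub> P" by (rule ideal_minus_mem[OF J'])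
    moreover have "x \<ominus> q = y" using y carr by (simp add: a_minus_def a_assoc r_neg)
    moreover have "k + e * (i - j) = (k + e * (i - Suc j)) + e"
      using Suc.prems by (simp add: Suc_diff_Suc[symmetric] Suc_le_eq)
    ultimately have "y \<in> M \<up> ((k + e * (i - Suc j)) + e) \<cdot> J \<up> j \<inter> (J \<up> Suc j <+>\<^bsub>R\<^esub> P)"
      using y(1) by (metis IntI)
    then have y': "y \<in> M \<up> (k + e * (i - Suc j)) \<cdot> J \<up> Suc j <+>\<^bsub>R\<^esub> P"
      using e[of "k + e * (i - Suc j)" j] by blast
    have "q \<in> M \<up> (k + e * (i - Suc j)) \<cdot> J \<up> Suc j <+>\<^bsub>R\<^esub> P"
      using subset_set_add(2)[OF ideal_prod_is_ideal[OF ids] P] y by blast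
    then show ?case
      using y' y(3) ideal_add_mem[OF add_ideals[OF ideal_prod_is_ideal[OF ids] P]] by blast
  qed
  from this[of _ _ i i for i] show ?thesis by (intro exI[of _ e]) auto
qed

end

section \<open>Growth of the lengths of powers of the maximal ideal\<close>

context noetherian_cring
begin

text \<open>Ascending chains of ideals stabilize, so proper containment read upwards is well
  founded.\<close>

lemma ideal_induct [consumes 1, case_names step]:
  assumes "ideal I R"
    and step: "\<And>I. \<lbrakk>ideal I R; \<And>J. \<lbrakk>ideal J R; I \<subset> J\<rbrakk> \<Longrightarrow> Q J\<rbrakk> \<Longrightarrow> Q I"
  shows "Q I"
proof -
  have "wf {(J, I). ideal I R \<and> ideal J R \<and> I \<subset> J}"
    unfolding wf_iff_no_infinite_down_chain
  proof
    assume "\<exists>f. \<forall>i. (f (Suc i), f i) \<in> {(J, I). ideal I R \<and> ideal J R \<and> I \<subset> J}"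
    then obtain f where "\<And>i. (f (Suc i), f i) \<in> {(J, I). ideal I R \<and> ideal J R \<and> I \<subset> J}"
      by blast
    then have f: "\<forall>i. ideal (f i) R \<and> f i \<subset> f (Suc i)" by simp
    then have fi: "\<And>i. ideal (f i) R" "\<And>i. f i \<subseteq> f (Suc i)" by auto
    have "\<exists>N. \<forall>n\<ge>N. f n = f N"
      by (rule ascending_ideals_stable[of f, OF fi]) blast
    then obtain N where "f (Suc N) = f N" by (meson le_SucI order_refl)
    then show False using f[rule_format, of N] by simp
  qed
  then show ?thesis
    using assms(1)
  proof (induction I rule: wf_induct_rule)
    case (less I)
    show ?case by (rule step[OF less.prems]) (use less in auto)
  qed
qed

lemma subset_maximalideal:
  assumes "ideal I R" "I \<noteq> carrier R"
  shows "\<exists>M. maximalideal M R \<and> I \<subseteq> M"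
  using assms
proof (induction I rule: ideal_induct)
  case (step I)
  show ?case
  proof (cases "maximalideal I R")
    case False
    then have "\<exists>J. ideal J R \<and> I \<subseteq> J \<and> J \<subseteq> carrier R \<and> J \<noteq> I \<and> J \<noteq> carrier R"
      using step(1,3) maximalidealI[OF step(1)] by metis
    then obtain J where J: "ideal J R" "I \<subset> J" "J \<noteq> carrier R" by blast
    then show ?thesis using step(2)[OF J] by blast
  qed auto
qed

end

section \<open>Upper bounds for lengths in terms of coheight\<close>

context cring
begin

definition prime_chain :: "'a set \<Rightarrow> (nat \<Rightarrow> 'a set) \<Rightarrow> nat \<Rightarrow> bool"
  where "prime_chain I P l \<longleftrightarrow> (\<forall>j\<le>l. primeideal (P j) R \<and> I \<subseteq> P j) \<and> (\<forall>j<l. P j \<subset> P (Suc j))"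

text \<open>Stands for \<open>dim (R/I) \<le> d\<close>, expressed through primes of
  \<open>R\<close> containing \<open>I\<close>.\<close>

definition coheight_le :: "'a set \<Rightarrow> nat \<Rightarrow> bool"
  where "coheight_le I d \<longleftrightarrow> (\<forall>P l. prime_chain I P l \<longrightarrow> l \<le> d)"

text \<open>An upper bound of degree \<open>d\<close> for the Hilbert-Samuel function of
  \<open>R/I\<close> with respect to \<open>M\<close>; the constant may depend on
  \<open>I\<close>.\<close>

definition growth_le :: "'a set \<Rightarrow> nat \<Rightarrow> 'a set \<Rightarrow> bool"
  where "growth_le M d I \<longleftrightarrow> (\<exists>c. \<forall>k. length_le (I <+>\<^bsub>R\<^esub> M \<up> k) (carrier R) (c * (k + 1) ^ d))"

lemma mem_PIdl_iff: "x \<in> carrier R \<Longrightarrow> y \<in> PIdl x \<longleftrightarrow> (\<exists>r\<in>carrier R. y = x \<otimes> r)"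
  unfolding cgenideal_def using m_comm by blast

text \<open>Multiplication by \<open>a\<close> induces a map on \<open>R/B\<close> whose image
  covers \<open>I\<close> modulo \<open>L\<close>. Both growth estimates below rest on it.\<close>

lemma length_le_mult:
  assumes a: "a \<in> carrier R" and I: "ideal I R" and B: "ideal B R" and L: "ideal L R"
    and len: "length_le B (carrier R) n"
    and aB: "\<And>y. y \<in> B \<Longrightarrow> a \<otimes> y \<in> L" and IL: "I \<subseteq> PIdl a <+>\<^bsub>R\<^esub> L"
  shows "length_le L I n"
proof (rule length_le_image[OF len oneideal, where f = "\<lambda>y. a \<otimes> y"])
  fix z assume "z \<in> I"
  then have "z \<in> PIdl a <+>\<^bsub>R\<^esub> L" using IL by blast
  then obtain y k where "y \<in> PIdl a" "k \<in> L" "z = y \<oplus> k" by (rule set_addE)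
  then show "\<exists>y\<in>carrier R. \<exists>k\<in>L. z = a \<otimes> y \<oplus> k" using mem_PIdl_iff[OF a, of y] by blast
qed (use a aB r_distr m_lcomm ideal_subset_carrier[OF B] in auto)

lemma length_le_maximal:
  assumes "maximalideal M R"
  shows "length_le M (carrier R) 1"
  unfolding length_le_def
proof (intro allI impI)
  fix l assume "ideal_chain M (carrier R) l"
  then obtain C where C: "\<And>j. j \<le> l \<Longrightarrow> ideal (C j) R \<and> M \<subseteq> C j \<and> C j \<subseteq> carrier R"
      "\<And>j. j < l \<Longrightarrow> C j \<subset> C (Suc j)"
    unfolding ideal_chain_def by blast
  have eq: "C j = M \<or> C j = carrier R" if "j \<le> l" for j
    using maximalideal.I_maximal[OF assms] C(1)[OF that] by blast
  show "l \<le> 1"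
  proof (rule ccontr)
    assume "\<not> l \<le> 1"
    then have "C 0 \<subset> C 1" "C 1 \<subset> C 2" "M \<subseteq> C 0" "C 2 \<subseteq> carrier R" "C 1 = M \<or> C 1 = carrier R"
      using C(2)[of 0] C(2)[of 1] C(1)[of 0] C(1)[of 2] eq[of 1] by (auto simp: numeral_2_eq_2)
    then show False by blast
  qed
qed

end

context noetherian_cring
begin

text \<open>If \<open>ab \<in> I\<close>, multiplication by \<open>a\<close> maps \<open>R/(I + bR + M\<^sup>k)\<close> onto \<open>(I + aR + M\<^sup>k)/(I + M\<^sup>k)\<close>.\<close>

lemma growth_le_if_prime_growth_le:
  assumes M: "ideal M R" and "ideal I R"
    and "\<And>Q. \<lbrakk>primeideal Q R; I \<subseteq> Q\<rbrakk> \<Longrightarrow> growth_le M d Q"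
  shows "growth_le M d I"
  using assms(2,3)
proof (induction I rule: ideal_induct)
  case (step I)
  note Mk = ideal_ideal_power[OF M]
  show ?case
  proof (cases "primeideal I R \<or> I = carrier R")
    case True
    have "growth_le M d I" if "I = carrier R"
    proof -
      have "length_le (I <+>\<^bsub>R\<^esub> M \<up> k) (carrier R) 0" for k
        using length_le_mono[OF length_le_self[of "carrier R"]] subset_set_add(1)[OF step(1) Mk] that
        by blast
      then show ?thesis unfolding growth_le_def by (intro exI[of _ 0]) simp
    qed
    then show ?thesis using True step by blast
  next
    case False
    then obtain a b where ab: "a \<in> carrier R" "b \<in> carrier R" "a \<otimes> b \<in> I" "a \<notin> I" "b \<notin> I"
      using ideal.primeidealCD[OF step(1) is_cring] by blast
    note Pa = cgenideal_ideal[OF ab(1)] and Pb = cgenideal_ideal[OF ab(2)]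
    note Ia = add_ideals[OF step(1) Pa] and Ib = add_ideals[OF step(1) Pb]
    have "I \<subset> I <+>\<^bsub>R\<^esub> PIdl a" "I \<subset> I <+>\<^bsub>R\<^esub> PIdl b"
      using subset_set_add[OF step(1) Pa] subset_set_add[OF step(1) Pb]
        cgenideal_self[OF ab(1)] cgenideal_self[OF ab(2)] ab(4,5) by auto
    then have "growth_le M d (I <+>\<^bsub>R\<^esub> PIdl a)" "growth_le M d (I <+>\<^bsub>R\<^esub> PIdl b)"
      using step(2)[OF Ia] step(2)[OF Ib] step(3) by blast+
    then obtain c1 c2 where
      c1: "\<And>k. length_le (I <+>\<^bsub>R\<^esub> PIdl a <+>\<^bsub>R\<^esub> M \<up> k) (carrier R) (c1 * (k + 1) ^ d)" and
      c2: "\<And>k. length_le (I <+>\<^bsub>R\<^esub> PIdl b <+>\<^bsub>R\<^esub> M \<up> k) (carrier R) (c2 * (k + 1) ^ d)"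
      unfolding growth_le_def by auto
    have "length_le (I <+>\<^bsub>R\<^esub> M \<up> k) (carrier R) ((c2 + c1) * (k + 1) ^ d)" for k
    proof -
      let ?L = "I <+>\<^bsub>R\<^esub> M \<up> k" and ?La = "I <+>\<^bsub>R\<^esub> PIdl a <+>\<^bsub>R\<^esub> M \<up> k"
      have L: "ideal ?L R" and La: "ideal ?La R" using add_ideals step(1) Ia Mk by blast+
      have IL: "I \<subseteq> ?L" "M \<up> k \<subseteq> ?L" using subset_set_add[OF step(1) Mk] by auto
      have "length_le ?L ?La (c2 * (k + 1) ^ d)"
      proof (rule length_le_mult[OF ab(1) La _ L c2])
        show "ideal (I <+>\<^bsub>R\<^esub> PIdl b <+>\<^bsub>R\<^esub> M \<up> k) R" by (rule add_ideals[OF Ib Mk])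
        show "?La \<subseteq> PIdl a <+>\<^bsub>R\<^esub> ?L"
          using subset_set_add[OF Pa L] IL by (intro set_add_least add_ideals Pa L) auto
        fix y assume "y \<in> I <+>\<^bsub>R\<^esub> PIdl b <+>\<^bsub>R\<^esub> M \<up> k"
        then obtain u w where "u \<in> I <+>\<^bsub>R\<^esub> PIdl b" "w \<in> M \<up> k" "y = u \<oplus> w"
          by (rule set_addE)
        moreover from this(1) obtain i v where "i \<in> I" "v \<in> PIdl b" "u = i \<oplus> v"
          by (rule set_addE)
        ultimately obtain i v w where "i \<in> I" "v \<in> PIdl b" "w \<in> M \<up> k" "y = i \<oplus> v \<oplus> w" by simp
        then obtain r where y: "i \<in> I" "r \<in> carrier R" "w \<in> M \<up> k" "y = i \<oplus> b \<otimes> r \<oplus> w"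
          using mem_PIdl_iff[OF ab(2), of v] by blast
        have carr: "i \<in> carrier R" "w \<in> carrier R"
          using y ideal.Icarr[OF step(1)] ideal.Icarr[OF Mk] by auto
        have "a \<otimes> y = a \<otimes> i \<oplus> (a \<otimes> b) \<otimes> r \<oplus> a \<otimes> w"
          using ab y carr by algebra
        moreover have "a \<otimes> i \<in> ?L" "(a \<otimes> b) \<otimes> r \<in> ?L" "a \<otimes> w \<in> ?L"
          using y ab IL ideal.I_l_closed[OF L] ideal.I_r_closed[OF L] by blast+
        ultimately show "a \<otimes> y \<in> ?L" using ideal_add_mem[OF L] by simp
      qed
      moreover have "?L \<subseteq> ?La"
        using set_add_mono[OF subset_set_add(1)[OF step(1) Pa]] by blast
      ultimately show ?thesis
        using length_le_add[OF _ c1 La oneideal] ideal_subset_carrier[OF La]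
        by (simp add: distrib_right)
    qed
    then show ?thesis unfolding growth_le_def by blast
  qed
qed

text \<open>Multiplication by \<open>x\<close> maps \<open>R/(Q + M^k)\<close> onto
  \<open>(Q + xR + M^(k+1))/(Q + M^(k+1))\<close>. So from \<open>k\<close> to \<open>k + 1\<close>
  the length grows by at most the length for \<open>Q + xR\<close>, and summing bounds of degree
  \<open>d\<close> gives degree \<open>d + 1\<close>.\<close>

lemma growth_le_Suc:
  assumes M: "ideal M R" and Q: "ideal Q R" and x: "x \<in> M"
    and growth: "growth_le M d (Q <+>\<^bsub>R\<^esub> PIdl x)"
  shows "growth_le M (Suc d) Q"
proof -
  have xc: "x \<in> carrier R" by (rule ideal.Icarr[OF M x])
  note Mk = ideal_ideal_power[OF M] and Px = cgenideal_ideal[OF xc]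
  note Qx = add_ideals[OF Q Px]
  obtain c where c: "\<And>k. length_le (Q <+>\<^bsub>R\<^esub> PIdl x <+>\<^bsub>R\<^esub> M \<up> k) (carrier R) (c * (k + 1) ^ d)"
    using growth unfolding growth_le_def by auto
  have "length_le (Q <+>\<^bsub>R\<^esub> M \<up> k) (carrier R) (c * (k + 1) ^ Suc d)" for k
  proof (induction k)
    case 0
    show ?case
      using length_le_mono[OF length_le_self[of "carrier R" 0]] subset_set_add(2)[OF Q oneideal] by simp
  next
    case (Suc k)
    let ?L = "Q <+>\<^bsub>R\<^esub> M \<up> Suc k" and ?Lx = "Q <+>\<^bsub>R\<^esub> PIdl x <+>\<^bsub>R\<^esub> M \<up> Suc k"
    have L: "ideal ?L R" and Lx: "ideal ?Lx R" using add_ideals Q Qx Mk by blast+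
    have QL: "Q \<subseteq> ?L" "M \<up> Suc k \<subseteq> ?L" using subset_set_add[OF Q Mk] by blast+
    have "length_le ?L ?Lx (c * (k + 1) ^ Suc d)"
    proof (rule length_le_mult[OF xc Lx _ L Suc])
      show "ideal (Q <+>\<^bsub>R\<^esub> M \<up> k) R" by (rule add_ideals[OF Q Mk])
      show "?Lx \<subseteq> PIdl x <+>\<^bsub>R\<^esub> ?L"
        using subset_set_add[OF Px L] QL by (intro set_add_least add_ideals Px L) auto
      fix y assume "y \<in> Q <+>\<^bsub>R\<^esub> M \<up> k"
      then obtain q w where y: "q \<in> Q" "w \<in> M \<up> k" "y = q \<oplus> w" unfolding set_add_iff by blast
      have carr: "q \<in> carrier R" "w \<in> carrier R"
        using y ideal.Icarr[OF Q] ideal.Icarr[OF Mk] by auto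
      have "x \<otimes> y = x \<otimes> q \<oplus> w \<otimes> x" using y carr xc by algebra
      moreover have "x \<otimes> q \<in> ?L" using y xc QL ideal.I_l_closed[OF L] by blast
      moreover have "w \<otimes> x \<in> M \<up> Suc k" using ideal_prod.prod[OF y(2) x, of R] by simp
      ultimately show "x \<otimes> y \<in> ?L" using QL ideal_add_mem[OF L] by auto
    qed
    moreover have "?L \<subseteq> ?Lx"
      using set_add_mono[OF subset_set_add(1)[OF Q Px]] by blast
    ultimately have "length_le ?L (carrier R) (c * (k + 1) ^ Suc d + c * (Suc k + 1) ^ d)"
      using length_le_add[OF _ c Lx oneideal] ideal_subset_carrier[OF Lx] by blast
    \<comment> \<open>The sum telescopes, because
      \<open>(k + 1) * (k + 2)^d + (k + 2)^d = (k + 2)^(d + 1)\<close>.\<close>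
    moreover have "(k + 1) ^ Suc d + (Suc k + 1) ^ d \<le> (Suc k + 1) ^ Suc d"
    proof -
      have "(k + 1) ^ Suc d \<le> (k + 1) * (Suc k + 1) ^ d"
        unfolding power_Suc by (intro mult_left_mono power_mono) auto
      then show ?thesis by simp
    qed
    then have "c * ((k + 1) ^ Suc d + (Suc k + 1) ^ d) \<le> c * (Suc k + 1) ^ Suc d"
      by (rule mult_left_mono) simp
    ultimately show ?case
      by (intro length_le_mono[of _ _ _ ?L "carrier R"]) (auto simp: distrib_left)
  qed
  then show ?thesis unfolding growth_le_def by blast
qed

text \<open>It suffices to treat primes \<open>Q\<close> above \<open>I\<close>. If \<open>Q\<close>
  is not \<open>M\<close>, any \<open>x\<close> in \<open>M\<close> outside \<open>Q\<close> lowers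
  the coheight, since a chain of primes above \<open>Q + xR\<close> extends downwards by
  \<open>Q\<close>; then \<open>growth_le_Suc\<close> applies. For \<open>d = 0\<close> the only
  prime above \<open>I\<close> is \<open>M\<close>.\<close>

theorem growth_le_coheight:
  assumes M: "maximalideal M R" and loc: "\<And>J. \<lbrakk>ideal J R; J \<noteq> carrier R\<rbrakk> \<Longrightarrow> J \<subseteq> M"
    and "ideal I R" "coheight_le I d"
  shows "growth_le M d I"
  using assms(3,4)
proof (induction d arbitrary: I)
  note Mid = maximalideal.axioms(1)[OF M]
  have base: "growth_le M d M" for d
  proof -
    have "length_le (M <+>\<^bsub>R\<^esub> M \<up> k) (carrier R) (1 * (k + 1) ^ d)" for k
      using length_le_mono[OF length_le_maximal[OF M] subset_set_add(1)[OF Mid ideal_ideal_power[OF Mid]]]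
      by simp
    then show ?thesis unfolding growth_le_def by blast
  qed
  have prime: "Q = M \<or> Q \<subset> M" if "primeideal Q R" for Q
    using loc[of Q] primeideal.axioms(1)[OF that] primeideal.I_notcarr[OF that] by blast
  {
    case 0
    show ?case
    proof (rule growth_le_if_prime_growth_le[OF Mid 0(1)])
      fix Q assume Q: "primeideal Q R" "I \<subseteq> Q"
      have "Q = M"
      proof (rule ccontr)
        assume "Q \<noteq> M"
        then have "prime_chain I (\<lambda>j. if j = 0 then Q else M) 1"
          using prime[OF Q(1)] Q maximalideal_prime[OF M] unfolding prime_chain_def by auto
        then show False using 0(2) unfolding coheight_le_def by fastforce
      qed
      then show "growth_le M 0 Q" using base by simp
    qed
  next
    case (Suc d)
    show ?case
    proof (rule growth_le_if_prime_growth_le[OF Mid Suc(2)])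
      fix Q assume Q: "primeideal Q R" "I \<subseteq> Q"
      show "growth_le M (Suc d) Q"
      proof (cases "Q = M")
        case False
        then obtain x where x: "x \<in> M" "x \<notin> Q" using prime[OF Q(1)] by blast
        have xc: "x \<in> carrier R" using x ideal.Icarr[OF Mid] by auto
        note Qid = primeideal.axioms(1)[OF Q(1)]
        note Px = cgenideal_ideal[OF xc]
        have sub: "Q \<subset> Q <+>\<^bsub>R\<^esub> PIdl x"
          using subset_set_add[OF Qid Px] cgenideal_self[OF xc] x by auto
        have "coheight_le (Q <+>\<^bsub>R\<^esub> PIdl x) d"
          unfolding coheight_le_def
        proof (intro allI impI)
          fix P l assume P: "prime_chain (Q <+>\<^bsub>R\<^esub> PIdl x) P l"
          have "prime_chain I (\<lambda>j. case j of 0 \<Rightarrow> Q | Suc j \<Rightarrow> P j) (Suc l)"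
            unfolding prime_chain_def
          proof (intro conjI allI impI)
            fix j
            show "primeideal (case j of 0 \<Rightarrow> Q | Suc j \<Rightarrow> P j) R"
              "I \<subseteq> (case j of 0 \<Rightarrow> Q | Suc j \<Rightarrow> P j)" if "j \<le> Suc l"
              using P Q sub that unfolding prime_chain_def by (auto split: nat.split)
            show "(case j of 0 \<Rightarrow> Q | Suc j \<Rightarrow> P j) \<subset> (case Suc j of 0 \<Rightarrow> Q | Suc j \<Rightarrow> P j)"
              if "j < Suc l"
              using P sub that unfolding prime_chain_def by (cases j) auto
          qed
          then have "Suc l \<le> Suc d" using Suc(3) unfolding coheight_le_def by blast
          then show "l \<le> d" by simp
        qed
        then show ?thesis using growth_le_Suc[OF Mid Qid x(1)] Suc(1)[OF add_ideals[OF Qid Px]] by blast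
      qed (use base in simp)
    qed
  }
qed

lemma artin_rees_principal:
  assumes M: "ideal M R" and P: "ideal P R" and x: "x \<in> carrier R"
  shows "\<exists>e0. \<forall>e\<ge>e0. \<forall>k. \<forall>y \<in> M \<up> (k + e) \<inter> (PIdl x <+>\<^bsub>R\<^esub> P). \<exists>w\<in>M \<up> k. \<exists>q\<in>P. y = x \<otimes> w \<oplus> q"
proof -
  note Mk = ideal_ideal_power[OF M] and Px = cgenideal_ideal[OF x]
  obtain e0 where e0: "\<And>k i. M \<up> (k + e0) \<cdot> (PIdl x) \<up> i \<inter> ((PIdl x) \<up> Suc i <+>\<^bsub>R\<^esub> P)
      \<subseteq> M \<up> k \<cdot> (PIdl x) \<up> Suc i <+>\<^bsub>R\<^esub> P"
    using artin_rees[OF M Px P] by blast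
  have prod: "\<exists>w\<in>M \<up> k. v = x \<otimes> w" if "v \<in> M \<up> k \<cdot> (PIdl x)" for v k
    using that
  proof (induction v rule: ideal_prod.induct)
    case (prod i j)
    then obtain r where r: "r \<in> carrier R" "j = x \<otimes> r" using mem_PIdl_iff[OF x] by blast
    have i: "i \<in> carrier R" using prod ideal.Icarr[OF Mk] by blast
    have "i \<otimes> j = x \<otimes> (r \<otimes> i)" using r i x by (simp add: m_ac)
    then show ?case using ideal.I_l_closed[OF Mk prod(1) r(1)] by blast
  next
    case (sum s1 s2)
    then obtain w1 w2 where w: "w1 \<in> M \<up> k" "w2 \<in> M \<up> k" "s1 = x \<otimes> w1" "s2 = x \<otimes> w2" by blast
    have "w1 \<in> carrier R" "w2 \<in> carrier R" using w ideal.Icarr[OF Mk] by blast+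
    then have "s1 \<oplus> s2 = x \<otimes> (w1 \<oplus> w2)" using w x by (simp add: r_distr)
    then show ?case using ideal_add_mem[OF Mk w(1,2)] by blast
  qed
  have "\<exists>w\<in>M \<up> k. \<exists>q\<in>P. y = x \<otimes> w \<oplus> q"
    if "e \<ge> e0" and y: "y \<in> M \<up> (k + e)" "y \<in> PIdl x <+>\<^bsub>R\<^esub> P" for e k y
  proof -
    have "y \<in> M \<up> (k + e0)" using y(1) ideal_power_antimono[OF M, of "k + e0" "k + e"] that by auto
    then have "y \<in> M \<up> k \<cdot> (PIdl x) <+>\<^bsub>R\<^esub> P"
      using e0[of k 0] y(2) Mk Px by (auto simp: ideal_prod_one ideals.l_one)
    then obtain v q where "v \<in> M \<up> k \<cdot> (PIdl x)" "q \<in> P" "y = v \<oplus> q" unfolding set_add_iff by blast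
    then show ?thesis using prod by blast
  qed
  then show ?thesis by blast
qed

text \<open>Multiplies the chain by \<open>x\<close> and adds \<open>P + M^n\<close>. If
  \<open>x y\<close> lies in the new \<open>j\<close>-th ideal, then \<open>x (y - z)\<close> lies
  in \<open>P + M^n\<close> for some \<open>z\<close> in \<open>C j\<close>; the assumption
  \<open>ar\<close> makes it \<open>x w\<close> modulo \<open>P\<close> with \<open>w\<close> in
  \<open>M^k\<close>, and cancelling \<open>x\<close> modulo the prime \<open>P\<close> puts
  \<open>y\<close> into \<open>C j\<close>. Hence strictness survives.\<close>

lemma ideal_chain_mult:
  assumes M: "ideal M R" and P: "primeideal P R" and x: "x \<in> carrier R" "x \<notin> P"
    and ar: "\<And>y. y \<in> M \<up> n \<inter> (PIdl x <+>\<^bsub>R\<^esub> P) \<Longrightarrow> \<exists>w\<in>M \<up> k. \<exists>q\<in>P. y = x \<otimes> w \<oplus> q"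
    and chain: "ideal_chain (P <+>\<^bsub>R\<^esub> M \<up> k) (carrier R) l"
  shows "ideal_chain (P <+>\<^bsub>R\<^esub> M \<up> n) (PIdl x <+>\<^bsub>R\<^esub> (P <+>\<^bsub>R\<^esub> M \<up> n)) l"
proof -
  note Pid = primeideal.axioms(1)[OF P]
  note Mk = ideal_ideal_power[OF M] and Px = cgenideal_ideal[OF x(1)]
  let ?L = "P <+>\<^bsub>R\<^esub> M \<up> n"
  have L: "ideal ?L R" by (rule add_ideals[OF Pid Mk])
  obtain C where C: "\<And>j. j \<le> l \<Longrightarrow> ideal (C j) R \<and> P <+>\<^bsub>R\<^esub> M \<up> k \<subseteq> C j \<and> C j \<subseteq> carrier R"
      "\<And>j. j < l \<Longrightarrow> C j \<subset> C (Suc j)"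
    using chain unfolding ideal_chain_def by blast
  define D where "D j = ((PIdl x) \<cdot> C j) <+>\<^bsub>R\<^esub> ?L" for j
  have xC: "\<exists>c\<in>C j. v = x \<otimes> c" if "v \<in> (PIdl x) \<cdot> C j" and j: "j \<le> l" for v j
    using that(1)
  proof (induction v rule: ideal_prod.induct)
    case (prod i c)
    then obtain r where r: "r \<in> carrier R" "i = x \<otimes> r" using mem_PIdl_iff[OF x(1)] by blast
    have "c \<in> carrier R" using prod C(1)[OF j] by blast
    then have "i \<otimes> c = x \<otimes> (r \<otimes> c)" using r x by (simp add: m_ac)
    moreover have "r \<otimes> c \<in> C j" using C(1)[OF j] prod r by (simp add: ideal.I_l_closed)
    ultimately show ?case by blast
  next
    case (sum s1 s2)
    then obtain w1 w2 where w: "w1 \<in> C j" "w2 \<in> C j" "s1 = x \<otimes> w1" "s2 = x \<otimes> w2" by blast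
    have "w1 \<in> carrier R" "w2 \<in> carrier R" using w C(1)[OF j] by blast+
    then have "s1 \<oplus> s2 = x \<otimes> (w1 \<oplus> w2)" using w x by (simp add: r_distr)
    then show ?case using ideal_add_mem w C(1)[OF j] by blast
  qed
  have "ideal (D j) R \<and> ?L \<subseteq> D j \<and> D j \<subseteq> PIdl x <+>\<^bsub>R\<^esub> ?L" if "j \<le> l" for j
  proof -
    have Cj: "ideal (C j) R" using C(1)[OF that] by blast
    have xCj: "ideal ((PIdl x) \<cdot> C j) R" "(PIdl x) \<cdot> C j \<subseteq> PIdl x"
      using ideal_prod_is_ideal[OF Px Cj] ideal_prod_inter[OF Px Cj] by auto
    then show ?thesis
      unfolding D_def using add_ideals[OF xCj(1) L] subset_set_add(2)[OF xCj(1) L] set_add_mono by blast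
  qed
  moreover have "D j \<subset> D (Suc j)" if j: "j < l" for j
  proof -
    have CC: "ideal (C j) R" "ideal (C (Suc j)) R" "P <+>\<^bsub>R\<^esub> M \<up> k \<subseteq> C j" "C j \<subset> C (Suc j)"
      using C(1)[of j] C(1)[of "Suc j"] C(2)[of j] j by auto
    then have PC: "P \<subseteq> C j" "M \<up> k \<subseteq> C j" using subset_set_add[OF Pid Mk, of k] by auto
    have sub: "D j \<subseteq> D (Suc j)" unfolding D_def using CC(4) by (intro set_add_mono ideal_prod_mono) auto
    obtain y where y: "y \<in> C (Suc j)" "y \<notin> C j" using CC by blast
    have yc: "y \<in> carrier R" using y ideal.Icarr[OF CC(2)] by blast
    have "x \<otimes> y \<in> (PIdl x) \<cdot> C (Suc j)" using y cgenideal_self[OF x(1)] by (intro ideal_prod.prod)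
    then have "x \<otimes> y \<in> D (Suc j)"
      unfolding D_def using subset_set_add(1)[OF ideal_prod_is_ideal[OF Px CC(2)] L] by blast
    moreover have "x \<otimes> y \<notin> D j"
    proof
      assume "x \<otimes> y \<in> D j"
      then obtain v t where "v \<in> (PIdl x) \<cdot> C j" "t \<in> ?L" "x \<otimes> y = v \<oplus> t"
        unfolding D_def by (rule set_addE)
      moreover from this(2) obtain q u where "q \<in> P" "u \<in> M \<up> n" "t = q \<oplus> u"
        by (rule set_addE)
      ultimately obtain v q u where "v \<in> (PIdl x) \<cdot> C j" "q \<in> P" "u \<in> M \<up> n"
        and eq: "x \<otimes> y = v \<oplus> (q \<oplus> u)" by simp
      then obtain z where z: "z \<in> C j" "v = x \<otimes> z" "q \<in> P" "u \<in> M \<up> n" using xC[of v j] j by auto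
      have carr: "z \<in> carrier R" "q \<in> carrier R" "u \<in> carrier R"
        using z ideal.Icarr[OF CC(1)] ideal.Icarr[OF Pid] ideal.Icarr[OF Mk] by blast+
      have "u = x \<otimes> (y \<ominus> z) \<oplus> \<ominus> q"
      proof -
        have "u = (x \<otimes> z \<oplus> (q \<oplus> u)) \<ominus> x \<otimes> z \<ominus> q" using carr x(1) by algebra
        also have "\<dots> = x \<otimes> y \<ominus> x \<otimes> z \<ominus> q" using eq z by simp
        also have "\<dots> = x \<otimes> (y \<ominus> z) \<oplus> \<ominus> q" using carr x(1) yc by algebra
        finally show ?thesis .
      qed
      moreover have "x \<otimes> (y \<ominus> z) \<in> PIdl x" using mem_PIdl_iff[OF x(1)] yc carr by blast
      moreover have "\<ominus> q \<in> P" using ideal_minus_mem[OF Pid ideal_zero_mem[OF Pid] z(3)] carr by (simp add: a_minus_def)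
      ultimately have "u \<in> M \<up> n \<inter> (PIdl x <+>\<^bsub>R\<^esub> P)"
        using z(4) set_addI[of "x \<otimes> (y \<ominus> z)" "PIdl x" "\<ominus> q" P] by simp
      then obtain w q' where w: "w \<in> M \<up> k" "q' \<in> P" "u = x \<otimes> w \<oplus> q'" using ar by blast
      have carr': "w \<in> carrier R" "q' \<in> carrier R"
        using w ideal.Icarr[OF Pid] ideal.Icarr[OF Mk] by blast+
      have "x \<otimes> (y \<ominus> z \<ominus> w) = x \<otimes> y \<ominus> x \<otimes> z \<ominus> x \<otimes> w" using carr carr' x(1) yc by algebra
      also have "\<dots> = (x \<otimes> z \<oplus> (q \<oplus> (x \<otimes> w \<oplus> q'))) \<ominus> x \<otimes> z \<ominus> x \<otimes> w" using eq z w by simp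
      also have "\<dots> = q \<oplus> q'" using carr carr' x(1) by algebra
      finally have "x \<otimes> (y \<ominus> z \<ominus> w) \<in> P" using ideal_add_mem[OF Pid z(3) w(2)] by simp
      then have "y \<ominus> z \<ominus> w \<in> P"
        using primeideal.I_prime[OF P x(1)] x(2) carr carr' yc by auto
      then have "(y \<ominus> z \<ominus> w) \<oplus> (z \<oplus> w) \<in> C j"
        using PC z w ideal_add_mem[OF CC(1)] by blast
      moreover have "(y \<ominus> z \<ominus> w) \<oplus> (z \<oplus> w) = y" using carr carr' yc by algebra
      ultimately show False using y by simp
    qed
    ultimately show ?thesis using sub by blast
  qed
  ultimately show ?thesis unfolding ideal_chain_def by blast
qed

text \<open>Induction along the chain, with \<open>x\<close> in \<open>P 1\<close> outside
  \<open>P 0\<close>. At \<open>j + 1\<close> one finds, below, the chain for \<open>j\<close>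
  multiplied by \<open>x\<close>, and above it a chain that the induction hypothesis gives for
  \<open>P 1\<close>; the lengths add up by Pascal's rule. The exponent \<open>e * (j + 1)\<close>
  is positive even at \<open>j = 0\<close>, where \<open>j choose 0\<close> already asks for a
  nonzero quotient.\<close>

theorem growth_ge_prime_chain:
  assumes M: "ideal M R" "M \<noteq> carrier R" and loc: "\<And>j. j \<le> l \<Longrightarrow> P j \<subseteq> M"
    and chain: "prime_chain I P l"
  shows "\<exists>e>0. \<forall>j. ideal_chain (P 0 <+>\<^bsub>R\<^esub> M \<up> (e * (j + 1))) (carrier R) (j choose l)"
  using loc chain
proof (induction l arbitrary: P)
  note Mk = ideal_ideal_power[OF M(1)]
  {
    case 0
    then have P: "primeideal (P 0) R" "P 0 \<subseteq> M" by (auto simp: prime_chain_def)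
    have "ideal_chain (P 0 <+>\<^bsub>R\<^esub> M \<up> (1 * (j + 1))) (carrier R) (j choose 0)" for j
    proof -
      have "M \<up> (j + 1) \<subseteq> M"
        using ideal_prod_inter[OF Mk M(1), of j] by simp
      then have "P 0 <+>\<^bsub>R\<^esub> M \<up> (1 * (j + 1)) \<subseteq> M" using P by (intro set_add_least M) auto
      moreover have "ideal_chain M (carrier R) 1"
        using ideal_chain_1[OF M(1) oneideal] M ideal_subset_carrier[OF M(1)] by blast
      ultimately show ?thesis using ideal_chain_mono by simp
    qed
    then show ?case by (intro exI[of _ 1]) auto
  next
    case (Suc l)
    have P0: "primeideal (P 0) R" and P1: "primeideal (P 1) R" and lt: "P 0 \<subset> P 1"
      using Suc.prems(2) unfolding prime_chain_def by auto
    note P0id = primeideal.axioms(1)[OF P0] and P1id = primeideal.axioms(1)[OF P1]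
    obtain x where x: "x \<in> P 1" "x \<notin> P 0" using lt by blast
    have xc: "x \<in> carrier R" using x ideal.Icarr[OF P1id] by blast
    note Px = cgenideal_ideal[OF xc]
    have "prime_chain I (\<lambda>j. P (Suc j)) l" using Suc.prems(2) unfolding prime_chain_def by auto
    from Suc.IH[OF _ this] Suc.prems(1) obtain e1 where e1: "e1 > 0"
      "\<And>j. ideal_chain (P 1 <+>\<^bsub>R\<^esub> M \<up> (e1 * (j + 1))) (carrier R) (j choose l)" by auto
    obtain e0 where e0: "\<And>e k y. \<lbrakk>e \<ge> e0; y \<in> M \<up> (k + e) \<inter> (PIdl x <+>\<^bsub>R\<^esub> P 0)\<rbrakk>
        \<Longrightarrow> \<exists>w\<in>M \<up> k. \<exists>q\<in>P 0. y = x \<otimes> w \<oplus> q"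
      using artin_rees_principal[OF M(1) P0id xc] by blast
    \<comment> \<open>\<open>e \<ge> e0\<close> makes \<open>e\<close> an admissible Artin-Rees loss
      in passing from \<open>j\<close> to \<open>j + 1\<close>, and \<open>e \<ge> e1\<close> puts
      \<open>M \<up> (e * (j + 2))\<close> inside \<open>M \<up> (e1 * (j + 1))\<close>.\<close>
    define e where "e = Suc e0 * e1"
    have "e0 \<le> e0 * e1" using e1(1) by simp
    then have "e0 \<le> e1 + e0 * e1" by linarith
    then have e: "e > 0" "e \<ge> e0" "e \<ge> e1" using e1(1) by (auto simp: e_def)
    have "ideal_chain (P 0 <+>\<^bsub>R\<^esub> M \<up> (e * (j + 1))) (carrier R) (j choose Suc l)" for j
    proof (induction j)
      case 0
      then show ?case
        using ideal_chain_0[OF oneideal] ideal_subset_carrier[OF add_ideals[OF P0id Mk]] by simp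
    next
      case (Suc j)
      let ?L = "P 0 <+>\<^bsub>R\<^esub> M \<up> (e * (Suc j + 1))"
      have L: "ideal ?L R" by (rule add_ideals[OF P0id Mk])
      have "e * (j + 1) + e = e * (Suc j + 1)" by simp
      note e0' = e0[OF e(2), of _ "e * (j + 1)", unfolded this]
      have "ideal_chain ?L (PIdl x <+>\<^bsub>R\<^esub> ?L) (j choose Suc l)"
        by (rule ideal_chain_mult[OF M(1) P0 xc x(2) e0' Suc])
      moreover have "ideal_chain (PIdl x <+>\<^bsub>R\<^esub> ?L) (carrier R) (j choose l)"
      proof (rule ideal_chain_mono[OF e1(2) _ subset_refl])
        let ?L1 = "P 1 <+>\<^bsub>R\<^esub> M \<up> (e1 * (j + 1))"
        have "e1 * (j + 1) \<le> e * (Suc j + 1)" using e(3) by (intro mult_le_mono) auto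
        then have "M \<up> (e * (Suc j + 1)) \<subseteq> M \<up> (e1 * (j + 1))" by (rule ideal_power_antimono[OF M(1)])
        then have "?L \<subseteq> ?L1" using lt by (intro set_add_mono) auto
        moreover have "PIdl x \<subseteq> ?L1"
          using cgenideal_minimal[OF P1id x(1)] subset_set_add(1)[OF P1id Mk] by blast
        ultimately show "PIdl x <+>\<^bsub>R\<^esub> ?L \<subseteq> ?L1"
          by (rule set_add_least[OF add_ideals[OF P1id Mk], rotated])
      qed
      ultimately have "ideal_chain ?L (carrier R) ((j choose Suc l) + (j choose l))"
        using ideal_chain_append[OF _ _ add_ideals[OF Px L] subset_set_add(2)[OF Px L]]
          ideal_subset_carrier[OF add_ideals[OF Px L]] by blast
      then show ?case by (simp add: add.commute)
    qed
    then show ?case using e by blast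
  }
qed

end

text \<open>At \<open>j = N t\<close> the binomial is at least \<open>t^N\<close>, while the bound
  is at most \<open>c (N + 1)^d t^d\<close>.\<close>

lemma choose_bounded_by_power_imp_le:
  assumes "\<And>j. j choose N \<le> c * (j + 1) ^ d"
  shows "N \<le> d"
proof (rule ccontr)
  assume "\<not> N \<le> d"
  then have N: "N \<ge> Suc d" by simp
  \<comment> \<open>One more than the constant in front of \<open>t^d\<close>, so that the bound
    falls below \<open>t^(d + 1)\<close>.\<close>
  define t where "t = c * (N + 1) ^ d + 1"
  have t: "t \<ge> 1" by (simp add: t_def)
  have "real t ^ N = (real (N * t) / real N) ^ N" using N by simp
  also have "\<dots> \<le> real (N * t choose N)" using N t by (intro binomial_ge_n_over_k_pow_k) auto
  also have "\<dots> \<le> real (c * (N * t + 1) ^ d)" using assms of_nat_le_iff by blast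
  finally have "t ^ N \<le> c * (N * t + 1) ^ d" by (metis of_nat_le_iff of_nat_power)
  also have "\<dots> \<le> c * ((N + 1) * t) ^ d" using t by (intro mult_left_mono power_mono) auto
  also have "\<dots> = (c * (N + 1) ^ d) * t ^ d" by (simp only: power_mult_distrib mult.assoc)
  also have "\<dots> < t * t ^ d" using t by (intro mult_strict_right_mono) (auto simp: t_def)
  also have "\<dots> \<le> t ^ N" using power_increasing[OF N, of t] t by simp
  finally show False by simp
qed

sublocale noetherian_domain \<subseteq> noetherian_cring
  by unfold_locales

section \<open>Dimension bound\<close>

text \<open>
  Let \<open>J = (sp : \<pi>)\<close>. Since \<open>\<pi>J = sp\<close>, dividing by \<open>(\<pi>/s)\<^sup>i\<close> identifies \<open>p\<^sup>i\<close> with \<open>J\<^sup>i\<close>; under this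
  identification \<open>p\<^sup>i\<^sup>+\<^sup>1\<close> corresponds to \<open>p \<inter> J\<^sup>i\<close>, because \<open>p\<^sup>i\<^sup>+\<^sup>1\<close> is \<open>p\<close>-primary. Hence
  \<open>p\<^sup>i/p\<^sup>i\<^sup>+\<^sup>1\<close> is the image of \<open>J\<^sup>i\<close> in \<open>A/p\<close>.
\<close>

context noetherian_domain
begin

text \<open>The assumptions are what the argument uses of the localization: \<open>\<pi>\<close>
  generates \<open>p\<close> there, with one denominator \<open>s\<close> for all of
  \<open>p\<close>, and elements outside \<open>p\<close> can be cancelled from membership in powers
  of \<open>p\<close>.\<close>

context
  fixes p :: "'a set" and \<pi> s :: 'a and M :: "'a set"
  assumes p: "primeideal p R" and M: "ideal M R" and pM: "p \<subseteq> M"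
    and \<pi>: "\<pi> \<in> p" "\<pi> \<noteq> \<zero>"
    and s: "s \<in> carrier R" "s \<notin> p"
    and sp: "\<And>y. y \<in> p \<Longrightarrow> \<exists>b\<in>carrier R. s \<otimes> y = \<pi> \<otimes> b"
    and primary: "\<And>n t x. \<lbrakk>t \<in> carrier R; t \<notin> p; x \<in> carrier R; t \<otimes> x \<in> p \<up> n\<rbrakk> \<Longrightarrow> x \<in> p \<up> n"
begin

definition colon :: "'a set"
  where "colon = {b \<in> carrier R. \<exists>y\<in>p. \<pi> \<otimes> b = s \<otimes> y}"

lemma p_ideal: "ideal p R"
  by (rule primeideal.axioms(1)[OF p])

lemma pi_carrier: "\<pi> \<in> carrier R"
  by (rule ideal.Icarr[OF p_ideal \<pi>(1)])

lemma ideal_colon: "ideal colon R"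
proof (rule idealI_comm)
  show "colon \<subseteq> carrier R" by (auto simp: colon_def)
  show "\<zero> \<in> colon" unfolding colon_def using pi_carrier s ideal_zero_mem[OF p_ideal] by force
next
  fix a b assume "a \<in> colon" "b \<in> colon"
  then obtain y z where *: "a \<in> carrier R" "b \<in> carrier R" "y \<in> p" "z \<in> p"
      "\<pi> \<otimes> a = s \<otimes> y" "\<pi> \<otimes> b = s \<otimes> z" unfolding colon_def by blast
  then have "\<pi> \<otimes> (a \<oplus> b) = s \<otimes> (y \<oplus> z)"
    using pi_carrier s ideal.Icarr[OF p_ideal] by (simp add: r_distr)
  then show "a \<oplus> b \<in> colon" unfolding colon_def using * ideal_add_mem[OF p_ideal] by blast
next
  fix r a assume r: "r \<in> carrier R" and "a \<in> colon"
  then obtain y where *: "a \<in> carrier R" "y \<in> p" "\<pi> \<otimes> a = s \<otimes> y" unfolding colon_def by blast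
  have y: "y \<in> carrier R" using * ideal.Icarr[OF p_ideal] by blast
  have "\<pi> \<otimes> (r \<otimes> a) = r \<otimes> (\<pi> \<otimes> a)" using pi_carrier r * by (intro m_lcomm)
  also have "\<dots> = s \<otimes> (r \<otimes> y)" using s r y * by (simp add: m_lcomm)
  finally show "r \<otimes> a \<in> colon"
    unfolding colon_def using * r ideal.I_l_closed[OF p_ideal] by blast
qed

lemmas pow_ideals = ideal_ideal_power[OF p_ideal] ideal_ideal_power[OF ideal_colon] ideal_ideal_power[OF M]

lemma pow_carrier [simp]: "\<pi> [^] (i::nat) \<in> carrier R" "s [^] (i::nat) \<in> carrier R"
  using pi_carrier s by auto

lemma colon_of_p: "x \<in> p \<Longrightarrow> \<exists>y\<in>colon. \<pi> \<otimes> y = s \<otimes> x"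
  using sp[of x] unfolding colon_def by force

lemma p_of_colon: "y \<in> colon \<Longrightarrow> \<exists>x\<in>p. \<pi> \<otimes> y = s \<otimes> x"
  unfolding colon_def by blast

text \<open>Carries the relation between \<open>p\<close> and \<open>colon\<close> to
  \<open>i\<close>-th powers, factor by factor. The letters are general because it is used in both
  directions, with the roles of \<open>\<pi>\<close> and \<open>s\<close> exchanged.\<close>

lemma power_transfer:
  assumes A: "ideal A R" and B: "ideal B R" and c: "c \<in> carrier R" and d: "d \<in> carrier R"
    and AB: "\<And>x. x \<in> A \<Longrightarrow> \<exists>y\<in>B. c \<otimes> y = d \<otimes> x" and x: "x \<in> A \<up> i"
  shows "\<exists>y\<in>B \<up> i. c [^] i \<otimes> y = d [^] i \<otimes> x"
  using x
proof (induction i arbitrary: x)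
  case (Suc i)
  note Ai = ideal_ideal_power[OF A] and Bi = ideal_ideal_power[OF B]
  have "x \<in> A \<up> i \<cdot> A" using Suc.prems by simp
  then show ?case
  proof (induction x rule: ideal_prod.induct)
    case (prod u v)
    obtain u' where u': "u' \<in> B \<up> i" "c [^] i \<otimes> u' = d [^] i \<otimes> u" using Suc.IH[OF prod(1)] by blast
    obtain v' where v': "v' \<in> B" "c \<otimes> v' = d \<otimes> v" using AB[OF prod(2)] by blast
    have carr: "u \<in> carrier R" "v \<in> carrier R" "u' \<in> carrier R" "v' \<in> carrier R"
      using prod u' v' ideal.Icarr[OF A] ideal.Icarr[OF B] ideal.Icarr[OF Ai] ideal.Icarr[OF Bi] by blast+
    have "c [^] Suc i \<otimes> (u' \<otimes> v') = (c [^] i \<otimes> u') \<otimes> (c \<otimes> v')" using carr c by (simp add: m_ac)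
    also have "\<dots> = d [^] Suc i \<otimes> (u \<otimes> v)" using carr d u' v' by (simp add: m_ac)
    finally show ?case using ideal_prod.prod[OF u'(1) v'(1), of R] by auto
  next
    case (sum x1 x2)
    then obtain y1 y2 where y: "y1 \<in> B \<up> Suc i" "c [^] Suc i \<otimes> y1 = d [^] Suc i \<otimes> x1"
        "y2 \<in> B \<up> Suc i" "c [^] Suc i \<otimes> y2 = d [^] Suc i \<otimes> x2" by blast
    have "x1 \<in> A \<up> Suc i" "x2 \<in> A \<up> Suc i" using sum by auto
    then have carr: "x1 \<in> carrier R" "x2 \<in> carrier R" "y1 \<in> carrier R" "y2 \<in> carrier R"
      using y ideal.Icarr[OF Ai] ideal.Icarr[OF Bi] by blast+
    have "c [^] Suc i \<otimes> (y1 \<oplus> y2) = d [^] Suc i \<otimes> (x1 \<oplus> x2)"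
      using carr c d y by (simp add: r_distr del: nat_pow_Suc)
    then show ?case using ideal_add_mem[OF Bi y(1,3)] by blast
  qed
qed (use c d in auto)

text \<open>Multiplication by the fraction \<open>(\<pi>/s)^i\<close>, carried out inside
  \<open>R\<close>. The value is unique because \<open>s\<close> is nonzero in a domain, and it
  exists for \<open>y\<close> in \<open>colon \<up> i\<close>.\<close>

definition div_map :: "nat \<Rightarrow> 'a \<Rightarrow> 'a"
  where "div_map i y = (THE x. x \<in> carrier R \<and> \<pi> [^] i \<otimes> y = s [^] i \<otimes> x)"

lemma s_pow_nonzero: "s [^] (i::nat) \<noteq> \<zero>"
  using s ideal_zero_mem[OF p_ideal] by (induction i) (auto simp: integral_iff)

lemma s_pow_notin: "s [^] (i::nat) \<notin> p"
proof (induction i)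
  case 0
  then show ?case using primeideal.I_notcarr[OF p] ideal.one_imp_carrier[OF p_ideal] by auto
next
  case (Suc i)
  then show ?case using primeideal.I_prime[OF p pow_carrier(2)[of i] s(1)] s(2) by auto
qed

lemma div_map_eqI:
  assumes "x \<in> carrier R" "\<pi> [^] i \<otimes> y = s [^] i \<otimes> x"
  shows "div_map i y = x"
  unfolding div_map_def
proof (rule the_equality)
  fix x' assume "x' \<in> carrier R \<and> \<pi> [^] i \<otimes> y = s [^] i \<otimes> x'"
  then show "x' = x" using assms m_lcancel[OF s_pow_nonzero[of i]] by auto
qed (use assms in auto)

lemma div_map:
  assumes "y \<in> colon \<up> i"
  shows "div_map i y \<in> p \<up> i" "\<pi> [^] i \<otimes> y = s [^] i \<otimes> div_map i y"
proof -
  have "\<And>y. y \<in> colon \<Longrightarrow> \<exists>x\<in>p. s \<otimes> x = \<pi> \<otimes> y" using p_of_colon by metis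
  from power_transfer[OF ideal_colon p_ideal s(1) pi_carrier this assms]
  obtain x where x: "x \<in> p \<up> i" "s [^] i \<otimes> x = \<pi> [^] i \<otimes> y" by blast
  then have "div_map i y = x" using ideal.Icarr[OF pow_ideals(1) x(1)] by (intro div_map_eqI) auto
  then show "div_map i y \<in> p \<up> i" "\<pi> [^] i \<otimes> y = s [^] i \<otimes> div_map i y" using x by auto
qed

lemma div_map_onto:
  assumes "x \<in> p \<up> i"
  shows "\<exists>y\<in>colon \<up> i. div_map i y = x"
proof -
  obtain y where "y \<in> colon \<up> i" "\<pi> [^] i \<otimes> y = s [^] i \<otimes> x"
    using power_transfer[OF p_ideal ideal_colon pi_carrier s(1) colon_of_p assms] by blast
  then show ?thesis using div_map_eqI ideal.Icarr[OF pow_ideals(1) assms] by blast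
qed

lemma div_map_carrier: "y \<in> colon \<up> i \<Longrightarrow> div_map i y \<in> carrier R"
  using div_map(1) ideal.Icarr[OF pow_ideals(1)] by blast

lemma div_map_add:
  assumes "y \<in> colon \<up> i" "z \<in> colon \<up> i"
  shows "div_map i (y \<oplus> z) = div_map i y \<oplus> div_map i z"
  using assms div_map(2) div_map_carrier ideal.Icarr[OF pow_ideals(2)]
  by (intro div_map_eqI) (auto simp: r_distr)

lemma div_map_mult:
  assumes "r \<in> carrier R" "y \<in> colon \<up> i"
  shows "div_map i (r \<otimes> y) = r \<otimes> div_map i y"
proof (rule div_map_eqI)
  have y: "y \<in> carrier R" using assms ideal.Icarr[OF pow_ideals(2)] by blast
  have "\<pi> [^] i \<otimes> (r \<otimes> y) = r \<otimes> (\<pi> [^] i \<otimes> y)" using assms y by (simp add: m_lcomm)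
  also have "\<dots> = s [^] i \<otimes> (r \<otimes> div_map i y)"
    using assms div_map(2) div_map_carrier by (simp add: m_lcomm)
  finally show "\<pi> [^] i \<otimes> (r \<otimes> y) = s [^] i \<otimes> (r \<otimes> div_map i y)" .
qed (use assms div_map_carrier in auto)

text \<open>Here the hypothesis on symbolic powers enters, through \<open>primary\<close>:
  \<open>\<pi>^i y\<close> lies in \<open>p^(i+1)\<close> and equals \<open>s^i\<close> times the
  image of \<open>y\<close>, and \<open>s^i\<close> is outside \<open>p\<close>.\<close>

lemma div_map_in_p:
  assumes "y \<in> colon \<up> i" "y \<in> p"
  shows "div_map i y \<in> p \<up> Suc i"
proof -
  have "\<pi> [^] i \<in> p \<up> i" for i :: nat
  proof (induction i)
    case (Suc i)
    then show ?case using ideal_prod.prod[OF Suc \<pi>(1), of R] by simp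
  qed simp
  then have "\<pi> [^] i \<otimes> y \<in> p \<up> Suc i" using ideal_prod.prod[OF _ assms(2), of _ "p \<up> i" R] by simp
  then have "s [^] i \<otimes> div_map i y \<in> p \<up> Suc i" using div_map(2)[OF assms(1)] by simp
  then show ?thesis
    using primary[OF pow_carrier(2) s_pow_notin div_map_carrier[OF assms(1)]] by blast
qed

text \<open>By linearity the image lies in \<open>M^k p^i\<close>, and
  \<open>p \<subseteq> M\<close> turns the factor \<open>p^i\<close> into \<open>i\<close> further
  powers of \<open>M\<close>.\<close>

lemma div_map_in_pow:
  assumes "y \<in> M \<up> k \<cdot> colon \<up> i"
  shows "div_map i y \<in> M \<up> (k + i)"
proof -
  have "M \<up> k \<cdot> p \<up> i \<subseteq> M \<up> k \<cdot> M \<up> i"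
    by (rule ideal_prod_mono[OF subset_refl ideal_power_mono[OF pM]])
  also have "\<dots> = M \<up> (k + i)" using M by (simp add: ideals.nat_pow_mult)
  finally have sub': "M \<up> k \<cdot> p \<up> i \<subseteq> M \<up> (k + i)" .
  \<comment> \<open>Membership in \<open>colon \<up> i\<close> is carried along because
    \<open>div_map_add\<close> requires it of both summands.\<close>
  have "y \<in> colon \<up> i \<and> div_map i y \<in> M \<up> (k + i)"
    using assms
  proof (induction y rule: ideal_prod.induct)
    case (prod w z)
    have w: "w \<in> carrier R" using ideal.Icarr[OF pow_ideals(3) prod(1)] .
    then have "div_map i (w \<otimes> z) \<in> M \<up> k \<cdot> p \<up> i"
      using div_map_mult[OF w prod(2)] ideal_prod.prod[OF prod(1) div_map(1)[OF prod(2)], of R] by simp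
    then show ?case using sub' ideal.I_l_closed[OF pow_ideals(2) prod(2) w] by blast
  next
    case (sum y1 y2)
    then show ?case
      using div_map_add ideal_add_mem[OF pow_ideals(2)] ideal_add_mem[OF pow_ideals(3)] by auto
  qed
  then show ?thesis ..
qed

text \<open>\<open>div_map i\<close> maps the quotient of \<open>colon \<up> i\<close> by its
  intersection with \<open>T = p + M^(n - i + e i)\<close> onto the graded piece, and this quotient
  embeds into \<open>R/T\<close>. In the exponent of \<open>T\<close>, Artin-Rees consumes
  \<open>e i\<close> and leaves \<open>n - i\<close>; \<open>div_map i\<close> supplies the missing
  \<open>i\<close>.\<close>

lemma length_le_symbolic_step:
  assumes e: "\<And>k i. (M \<up> (k + e * i) <+>\<^bsub>R\<^esub> p) \<inter> (colon \<up> i <+>\<^bsub>R\<^esub> p) \<subseteq> M \<up> k \<cdot> colon \<up> i <+>\<^bsub>R\<^esub> p"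
    and len: "length_le (p <+>\<^bsub>R\<^esub> M \<up> (n + e * n)) (carrier R) B" and i: "i \<le> n"
  shows "length_le (p \<up> Suc i <+>\<^bsub>R\<^esub> M \<up> n) (p \<up> i <+>\<^bsub>R\<^esub> M \<up> n) B"
proof (rule length_le_image[where f = "div_map i"])
  let ?T = "p <+>\<^bsub>R\<^esub> M \<up> (n - i + e * i)"
  have T: "ideal ?T R" by (rule add_ideals[OF p_ideal pow_ideals(3)])
  \<comment> \<open>One exponent for every \<open>i \<le> n\<close>, so that all graded pieces share
    the bound \<open>B\<close>.\<close>
  have "n - i + e * i \<le> n + e * n" using i by (intro add_mono mult_le_mono) auto
  then have "p <+>\<^bsub>R\<^esub> M \<up> (n + e * n) \<subseteq> ?T"
    using ideal_power_antimono[OF M] by (intro set_add_mono) auto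
  then have "length_le ?T (carrier R) B" using length_le_mono[OF len] by blast
  then show "length_le (colon \<up> i \<inter> ?T) (colon \<up> i) B"
    by (rule length_le_inter[OF _ T pow_ideals(2)])
  show "ideal (colon \<up> i) R" by (rule pow_ideals(2))
  show "colon \<up> i \<inter> ?T \<subseteq> colon \<up> i" by blast
  show "div_map i y \<in> carrier R" if "y \<in> colon \<up> i" for y using div_map_carrier[OF that] .
  show "div_map i (y \<oplus> z) = div_map i y \<oplus> div_map i z" if "y \<in> colon \<up> i" "z \<in> colon \<up> i" for y z
    using div_map_add[OF that] .
  show "div_map i (r \<otimes> y) = r \<otimes> div_map i y" if "r \<in> carrier R" "y \<in> colon \<up> i" for r y
    using div_map_mult[OF that] .
  show "\<exists>y\<in>colon \<up> i. \<exists>k\<in>p \<up> Suc i <+>\<^bsub>R\<^esub> M \<up> n. z = div_map i y \<oplus> k"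
    if z: "z \<in> p \<up> i <+>\<^bsub>R\<^esub> M \<up> n" for z
  proof -
    obtain x w where xw: "x \<in> p \<up> i" "w \<in> M \<up> n" "z = x \<oplus> w" using z by (rule set_addE)
    moreover have "w \<in> p \<up> Suc i <+>\<^bsub>R\<^esub> M \<up> n"
      using subset_set_add(2)[OF pow_ideals(1,3)] xw by blast
    ultimately show ?thesis using div_map_onto[OF xw(1)] by blast
  qed
  fix y assume "y \<in> colon \<up> i \<inter> ?T"
  then have y: "y \<in> colon \<up> i" "y \<in> ?T" by auto
  have "y \<in> colon \<up> i <+>\<^bsub>R\<^esub> p" using subset_set_add(1)[OF pow_ideals(2) p_ideal] y by blast
  moreover have "y \<in> M \<up> (n - i + e * i) <+>\<^bsub>R\<^esub> p"
    using y(2) unfolding set_add_comm[OF ideal_subset_carrier[OF p_ideal] ideal_subset_carrier[OF pow_ideals(3)]] .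
  ultimately have "y \<in> M \<up> (n - i) \<cdot> colon \<up> i <+>\<^bsub>R\<^esub> p" using e by blast
  then obtain u q where uq: "u \<in> M \<up> (n - i) \<cdot> colon \<up> i" "q \<in> p" "y = u \<oplus> q" by (rule set_addE)
  have u: "u \<in> colon \<up> i" using uq(1) ideal_prod_inter[OF pow_ideals(3,2)] by blast
  have carr: "u \<in> carrier R" "q \<in> carrier R"
    using u uq(2) ideal.Icarr[OF pow_ideals(2)] ideal.Icarr[OF p_ideal] by blast+
  \<comment> \<open>The part \<open>q\<close> in \<open>p\<close> also lies in
    \<open>colon \<up> i\<close>, being a difference of two of its elements; hence
    \<open>div_map_in_p\<close> applies to it.\<close>
  have "q = y \<ominus> u" unfolding uq using carr by algebra
  then have q: "q \<in> colon \<up> i" using ideal_minus_mem[OF pow_ideals(2) y(1) u] by simp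
  have "div_map i y = div_map i q \<oplus> div_map i u"
    using div_map_add[OF u q] uq(3) div_map_carrier u q a_comm by simp
  moreover have "div_map i u \<in> M \<up> n" using div_map_in_pow[OF uq(1)] i by simp
  ultimately show "div_map i y \<in> p \<up> Suc i <+>\<^bsub>R\<^esub> M \<up> n"
    using set_addI[OF div_map_in_p[OF q uq(2)], of "div_map i u" "M \<up> n"] by simp
qed

text \<open>Adds up the steps \<open>i < n\<close> of the filtration by \<open>p^i + M^n\<close>,
  which runs from \<open>R\<close> down to \<open>M^n\<close> because
  \<open>p^n \<subseteq> M^n\<close>.\<close>

lemma length_le_power:
  assumes e: "\<And>k i. (M \<up> (k + e * i) <+>\<^bsub>R\<^esub> p) \<inter> (colon \<up> i <+>\<^bsub>R\<^esub> p) \<subseteq> M \<up> k \<cdot> colon \<up> i <+>\<^bsub>R\<^esub> p"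
    and len: "length_le (p <+>\<^bsub>R\<^esub> M \<up> (n + e * n)) (carrier R) B"
  shows "length_le (M \<up> n) (carrier R) (n * B)"
proof -
  have id: "ideal (p \<up> i <+>\<^bsub>R\<^esub> M \<up> n) R" for i by (rule add_ideals[OF pow_ideals(1,3)])
  have "length_le (p \<up> i <+>\<^bsub>R\<^esub> M \<up> n) (carrier R) (i * B)" if "i \<le> n" for i
    using that
  proof (induction i)
    case 0
    have "carrier R \<subseteq> p \<up> 0 <+>\<^bsub>R\<^esub> M \<up> n" using subset_set_add(1)[OF oneideal pow_ideals(3)] by simp
    then show ?case using length_le_mono[OF length_le_self[of "carrier R"]] by blast
  next
    case (Suc i)
    have "p \<up> Suc i <+>\<^bsub>R\<^esub> M \<up> n \<subseteq> p \<up> i <+>\<^bsub>R\<^esub> M \<up> n"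
      using ideal_power_antimono[OF p_ideal, of i "Suc i"] by (intro set_add_mono) auto
    then show ?case
      using length_le_add[OF length_le_symbolic_step[OF e len, of i] Suc.IH id oneideal] Suc.prems
        ideal_subset_carrier[OF id] by simp
  qed
  then have "length_le (p \<up> n <+>\<^bsub>R\<^esub> M \<up> n) (carrier R) (n * B)" by simp
  moreover have "p \<up> n <+>\<^bsub>R\<^esub> M \<up> n \<subseteq> M \<up> n"
    by (rule set_add_least[OF pow_ideals(3) ideal_power_mono[OF pM] subset_refl])
  ultimately show ?thesis by (rule length_le_mono) auto
qed

text \<open>Modulo \<open>M \<up> (E * (j + 1))\<close> the chain forces a length of at least
  \<open>j choose l\<close>, whereas the filtration by powers of \<open>p\<close> allows at most a
  constant times \<open>(j + 1)^(d + 1)\<close>.\<close>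

lemma prime_chain_length_le:
  assumes max: "maximalideal M R" and loc: "\<And>J. \<lbrakk>ideal J R; J \<noteq> carrier R\<rbrakk> \<Longrightarrow> J \<subseteq> M"
    and coheight: "coheight_le p d" and chain: "prime_chain I P l"
  shows "l \<le> Suc d"
proof -
  obtain e where e: "\<And>k i. (M \<up> (k + e * i) <+>\<^bsub>R\<^esub> p) \<inter> (colon \<up> i <+>\<^bsub>R\<^esub> p)
      \<subseteq> M \<up> k \<cdot> colon \<up> i <+>\<^bsub>R\<^esub> p"
    using uniform_artin_rees[OF M ideal_colon p_ideal] by blast
  obtain c where c: "\<And>k. length_le (p <+>\<^bsub>R\<^esub> M \<up> k) (carrier R) (c * (k + 1) ^ d)"
    using growth_le_coheight[OF max loc p_ideal coheight] unfolding growth_le_def by blast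
  have upper: "length_le (M \<up> n) (carrier R) (n * (c * (n + e * n + 1) ^ d))" for n
    by (rule length_le_power[OF e c])
  have P: "primeideal (P j) R" if "j \<le> l" for j using chain that unfolding prime_chain_def by blast
  have "P j \<subseteq> M" if "j \<le> l" for j
    using loc primeideal.axioms(1)[OF P[OF that]] primeideal.I_notcarr[OF P[OF that]] by blast
  from growth_ge_prime_chain[OF M _ this chain] maximalideal.I_notcarr[OF max]
  obtain E where E: "E > 0"
    "\<And>j. ideal_chain (P 0 <+>\<^bsub>R\<^esub> M \<up> (E * (j + 1))) (carrier R) (j choose l)" by auto
  have "j choose l \<le> (E * c * (E + e * E + 1) ^ d) * (j + 1) ^ Suc d" for j
  proof -
    let ?n = "E * (j + 1)"
    have "ideal_chain (M \<up> ?n) (carrier R) (j choose l)"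
      using ideal_chain_mono[OF E(2) subset_set_add(2)] primeideal.axioms(1)[OF P] pow_ideals by blast
    then have "j choose l \<le> ?n * (c * (?n + e * ?n + 1) ^ d)" using upper length_le_def by blast
    also have "\<dots> \<le> ?n * (c * ((E + e * E + 1) * (j + 1)) ^ d)"
      by (intro mult_le_mono power_mono order_refl) (auto simp: algebra_simps)
    also have "\<dots> = (E * c * (E + e * E + 1) ^ d) * (j + 1) ^ Suc d"
      by (simp only: power_mult_distrib power_Suc mult_ac)
    finally show ?thesis .
  qed
  then show ?thesis by (rule choose_bounded_by_power_imp_le)
qed

end

end

section \<open>The localization at a prime ideal\<close>

context domain
begin

context
  fixes p :: "'a set"
  assumes p: "primeideal p R"
begin

abbreviation "S \<equiv> carrier R - p"
abbreviation "L \<equiv> localization_at R p"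
abbreviation "quot \<equiv> fraction R S"

lemma zero_in_prime: "\<zero> \<in> p"
  using ideal_zero_mem primeideal.axioms(1)[OF p] by blast

lemma denominatorD: "t \<in> S \<Longrightarrow> t \<in> carrier R" "t \<in> S \<Longrightarrow> t \<noteq> \<zero>"
  using zero_in_prime by auto

lemma denominator_mult: "\<lbrakk>t \<in> S; u \<in> S\<rbrakk> \<Longrightarrow> t \<otimes> u \<in> S"
  using primeideal.I_prime[OF p] by auto

lemma denominator_one: "\<one> \<in> S"
  using primeideal.I_notcarr[OF p] ideal.one_imp_carrier[OF primeideal.axioms(1)[OF p]] by auto

text \<open>In a domain the annihilating element \<open>u\<close> can be cancelled: it is nonzero
  because 0 lies in \<open>p\<close>.\<close>

lemma mem_fraction_iff:
  assumes a: "a \<in> carrier R" and s: "s \<in> S"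
  shows "(b, t) \<in> quot a s \<longleftrightarrow> b \<in> carrier R \<and> t \<in> S \<and> a \<otimes> t = b \<otimes> s"
proof -
  have "(\<exists>u\<in>S. u \<otimes> ((a \<otimes> t) \<ominus> (b \<otimes> s)) = \<zero>) \<longleftrightarrow> a \<otimes> t = b \<otimes> s"
    if "b \<in> carrier R" "t \<in> S"
  proof
    assume "\<exists>u\<in>S. u \<otimes> ((a \<otimes> t) \<ominus> (b \<otimes> s)) = \<zero>"
    then obtain u where u: "u \<in> S" "u \<otimes> ((a \<otimes> t) \<ominus> (b \<otimes> s)) = \<zero>" by blast
    then have "(a \<otimes> t) \<ominus> (b \<otimes> s) = \<zero>"
      using integral[OF u(2)] denominatorD[OF u(1)] a s that by auto
    then show "a \<otimes> t = b \<otimes> s" using a s that by (simp add: r_right_minus_eq)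
  next
    assume "a \<otimes> t = b \<otimes> s"
    then show "\<exists>u\<in>S. u \<otimes> ((a \<otimes> t) \<ominus> (b \<otimes> s)) = \<zero>"
      using a s that denominator_one by (intro bexI[of _ \<one>]) (auto simp: r_right_minus_eq)
  qed
  then show ?thesis unfolding fraction_def by auto
qed

lemma fraction_eq_iff:
  assumes "a \<in> carrier R" "s \<in> S" "b \<in> carrier R" "t \<in> S"
  shows "quot a s = quot b t \<longleftrightarrow> a \<otimes> t = b \<otimes> s"
proof
  assume "quot a s = quot b t"
  then have "(b, t) \<in> quot a s" using mem_fraction_iff[of b t b t] assms by simp
  then show "a \<otimes> t = b \<otimes> s" using mem_fraction_iff assms by blast
next
  have sub: "quot a s \<subseteq> quot b t" if eq: "a \<otimes> t = b \<otimes> s"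
    and *: "a \<in> carrier R" "s \<in> S" "b \<in> carrier R" "t \<in> S" for a s b t
  proof clarify
    fix c u assume "(c, u) \<in> quot a s"
    then have c: "c \<in> carrier R" "u \<in> S" "a \<otimes> u = c \<otimes> s" using mem_fraction_iff[OF *(1,2)] by auto
    note carr = c(1) denominatorD(1)[OF c(2)] *(1,3) denominatorD(1)[OF *(2)] denominatorD(1)[OF *(4)]
    have "s \<otimes> (b \<otimes> u) = (b \<otimes> s) \<otimes> u" using carr by (simp add: m_ac)
    also have "\<dots> = t \<otimes> (a \<otimes> u)" using carr by (simp add: eq[symmetric] m_ac)
    also have "\<dots> = s \<otimes> (c \<otimes> t)" using carr by (simp add: c(3) m_ac)
    finally have "b \<otimes> u = c \<otimes> t"
      using m_lcancel[OF denominatorD(2)[OF *(2)]] carr by simp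
    then show "(c, u) \<in> quot b t" using mem_fraction_iff[OF *(3,4)] c by blast
  qed
  assume "a \<otimes> t = b \<otimes> s"
  then show "quot a s = quot b t" using sub[of a t b s] sub[of b s a t] assms by auto
qed

lemma carrier_localization_at: "carrier L = {quot a s | a s. a \<in> carrier R \<and> s \<in> S}"
  by (simp add: localization_at_def localization_def)

text \<open>All representatives contribute the same class and the index sets are nonempty, so the
  union collapses to that class.\<close>

lemma fraction_mult:
  assumes "a \<in> carrier R" "s \<in> S" "b \<in> carrier R" "t \<in> S"
  shows "quot a s \<otimes>\<^bsub>L\<^esub> quot b t = quot (a \<otimes> b) (s \<otimes> t)"
proof -
  have "quot (c \<otimes> d) (u \<otimes> v) = quot (a \<otimes> b) (s \<otimes> t)"
    if "(c, u) \<in> quot a s" "(d, v) \<in> quot b t" for c u d v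
  proof -
    have c: "c \<in> carrier R" "u \<in> S" "a \<otimes> u = c \<otimes> s" and d: "d \<in> carrier R" "v \<in> S" "b \<otimes> v = d \<otimes> t"
      using that mem_fraction_iff assms by auto
    note carr = assms(1,3) c(1) d(1) assms(2,4)[THEN denominatorD(1)] c(2)[THEN denominatorD(1)]
      d(2)[THEN denominatorD(1)]
    have "(c \<otimes> d) \<otimes> (s \<otimes> t) = (c \<otimes> s) \<otimes> (d \<otimes> t)" using carr by (simp add: m_ac)
    also have "\<dots> = (a \<otimes> u) \<otimes> (b \<otimes> v)" using c d by simp
    also have "\<dots> = (a \<otimes> b) \<otimes> (u \<otimes> v)" using carr by (simp add: m_ac)
    finally show ?thesis
      using assms c d carr denominator_mult by (subst fraction_eq_iff) auto
  qed
  then have "(\<Union>(c, u)\<in>quot a s. \<Union>(d, v)\<in>quot b t. quot (c \<otimes> d) (u \<otimes> v)) =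
      (\<Union>x\<in>quot a s. \<Union>y\<in>quot b t. quot (a \<otimes> b) (s \<otimes> t))"
    by (intro SUP_cong refl) (simp add: split_def)
  moreover have "(a, s) \<in> quot a s" "(b, t) \<in> quot b t" using mem_fraction_iff assms by auto
  then have "quot a s \<noteq> {}" "quot b t \<noteq> {}" by blast+
  moreover have "quot a s \<otimes>\<^bsub>L\<^esub> quot b t = (\<Union>(c, u)\<in>quot a s. \<Union>(d, v)\<in>quot b t. quot (c \<otimes> d) (u \<otimes> v))"
    by (simp add: localization_at_def localization_def)
  ultimately show ?thesis by (simp only: UN_constant if_False)
qed

lemma one_localization_at: "\<one>\<^bsub>L\<^esub> = quot \<one> \<one>"
  by (simp add: localization_at_def localization_def)

lemma zero_localization_at: "\<zero>\<^bsub>L\<^esub> = quot \<zero> \<one>"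
  by (simp add: localization_at_def localization_def)

text \<open>In the localization \<open>x/1\<close> is the multiple of \<open>(t x)/1\<close> by
  \<open>1/t\<close>, so it lies in every ideal containing \<open>(t x)/1\<close>.\<close>

lemma symbolic_power_primary:
  assumes L: "ring L" and t: "t \<in> S" and x: "x \<in> carrier R"
    and tx: "t \<otimes> x \<in> p [^]\<^bsub>ideals_set R\<^esub> n" and sub: "p [^]\<^bsub>ideals_set R\<^esub> n \<subseteq> carrier R"
  shows "x \<in> symbolic_power R p n"
proof -
  let ?X = "to_localization_at R p ` (p [^]\<^bsub>ideals_set R\<^esub> n)"
  have loc: "quot y \<one> \<in> carrier L" if "y \<in> carrier R" for y
    using that denominator_one unfolding carrier_localization_at by blast
  have X: "?X \<subseteq> carrier L" using sub loc by (auto simp: to_localization_at_def)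
  note tc = denominatorD(1)[OF t]
  have "quot \<one> t \<in> carrier L" using t unfolding carrier_localization_at by blast
  moreover have "quot (t \<otimes> x) \<one> \<in> Idl\<^bsub>L\<^esub> ?X"
    using ring.genideal_self[OF L X] tx by (auto simp: to_localization_at_def)
  ultimately have "quot \<one> t \<otimes>\<^bsub>L\<^esub> quot (t \<otimes> x) \<one> \<in> Idl\<^bsub>L\<^esub> ?X"
    using ideal.I_l_closed[OF ring.genideal_ideal[OF L X]] by blast
  moreover have "quot \<one> t \<otimes>\<^bsub>L\<^esub> quot (t \<otimes> x) \<one> = quot x \<one>"
    using t x tc denominator_one by (simp add: fraction_mult fraction_eq_iff m_comm)
  ultimately show ?thesis using x by (simp add: symbolic_power_def to_localization_at_def)
qed

text \<open>The witness is the numerator \<open>a\<close> of a generator of the maximal ideal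
  \<open>m\<close> of \<open>L\<close>. It lies in \<open>p\<close>, as otherwise the generator
  would be a unit, and is nonzero because \<open>L\<close> is not a field. For \<open>y\<close> in
  \<open>p\<close> the fraction \<open>y/1\<close> is not a unit, hence lies in \<open>m\<close>;
  clearing denominators gives the relation in \<open>R\<close>.\<close>

lemma uniformizer:
  assumes L: "discrete_valuation_ring L"
  shows "\<exists>\<pi>\<in>p. \<pi> \<noteq> \<zero> \<and> (\<forall>y\<in>p. \<exists>t\<in>S. \<exists>b\<in>carrier R. t \<otimes> y = \<pi> \<otimes> b)"
proof -
  interpret L: discrete_valuation_ring L by (rule L)
  obtain m where m: "maximalideal m L" and uniq: "\<And>m'. maximalideal m' L \<Longrightarrow> m' = m"
    using L.ex1_maximalideal by blast
  obtain g where g: "g \<in> carrier L" "m = PIdl\<^bsub>L\<^esub> g"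
    using L.exists_gen[OF maximalideal.axioms(1)[OF m]] by blast
  then obtain a t where at: "a \<in> carrier R" "t \<in> S" "g = quot a t"
    unfolding carrier_localization_at by blast
  note tc = denominatorD(1)[OF at(2)]
  have "a \<in> p"
  proof (rule ccontr)
    assume "a \<notin> p"
    then have a: "a \<in> S" using at by blast
    then have "quot t a \<in> carrier L" using tc unfolding carrier_localization_at by blast
    moreover have "quot t a \<otimes>\<^bsub>L\<^esub> g = \<one>\<^bsub>L\<^esub>"
      unfolding at(3) one_localization_at using at(1,2) a tc denominator_one denominator_mult
      by (simp add: fraction_mult fraction_eq_iff m_comm)
    ultimately have "\<one>\<^bsub>L\<^esub> \<in> m" unfolding g(2) cgenideal_def by force
    then show False
      using ideal.one_imp_carrier[OF maximalideal.axioms(1)[OF m]] maximalideal.I_notcarr[OF m] by blast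
  qed
  moreover have "a \<noteq> \<zero>"
  proof
    assume "a = \<zero>"
    then have "g = \<zero>\<^bsub>L\<^esub>"
      unfolding at(3) zero_localization_at using at tc denominator_one by (simp add: fraction_eq_iff)
    then have "m = {\<zero>\<^bsub>L\<^esub>}" using g L.cgenideal_eq_genideal L.genideal_zero by auto
    then show False using m L.zeromaximalideal_fieldI L.not_field by blast
  qed
  moreover have "\<exists>t\<in>S. \<exists>b\<in>carrier R. t \<otimes> y = a \<otimes> b" if y: "y \<in> p" for y
  proof -
    have yc: "y \<in> carrier R" using y ideal.Icarr[OF primeideal.axioms(1)[OF p]] by blast
    have Y: "quot y \<one> \<in> carrier L" using yc denominator_one unfolding carrier_localization_at by blast
    have "PIdl\<^bsub>L\<^esub> (quot y \<one>) \<noteq> carrier L"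
    proof
      assume "PIdl\<^bsub>L\<^esub> (quot y \<one>) = carrier L"
      then obtain X where "X \<in> carrier L" "\<one>\<^bsub>L\<^esub> = X \<otimes>\<^bsub>L\<^esub> quot y \<one>"
        using L.one_closed unfolding cgenideal_def by auto
      then obtain b r where b: "b \<in> carrier R" "r \<in> S" "\<one>\<^bsub>L\<^esub> = quot b r \<otimes>\<^bsub>L\<^esub> quot y \<one>"
        unfolding carrier_localization_at by blast
      then have "r = b \<otimes> y"
        unfolding one_localization_at using yc denominator_one
        by (simp add: fraction_mult fraction_eq_iff)
      then show False
        using b ideal.I_l_closed[OF primeideal.axioms(1)[OF p] y b(1)] by blast
    qed
    then obtain m' where "maximalideal m' L" "PIdl\<^bsub>L\<^esub> (quot y \<one>) \<subseteq> m'"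
      using L.subset_maximalideal[OF L.cgenideal_ideal[OF Y]] by blast
    then have "quot y \<one> \<in> m" using uniq L.cgenideal_self[OF Y] by blast
    then obtain X where "X \<in> carrier L" "quot y \<one> = X \<otimes>\<^bsub>L\<^esub> g" unfolding g(2) cgenideal_def by blast
    then obtain b r where b: "b \<in> carrier R" "r \<in> S" "quot y \<one> = quot b r \<otimes>\<^bsub>L\<^esub> quot a t"
      unfolding carrier_localization_at at(3) by blast
    then have "y \<otimes> (r \<otimes> t) = b \<otimes> a"
      using yc at denominator_one denominator_mult[OF b(2) at(2)]
      by (simp add: fraction_mult fraction_eq_iff)
    then have "(r \<otimes> t) \<otimes> y = a \<otimes> b" using yc b tc at(1) by (simp add: m_comm)
    then show ?thesis using denominator_mult[OF b(2) at(2)] b(1) by blast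
  qed
  ultimately show ?thesis by blast
qed

end

end

text \<open>As \<open>p\<close> is finitely generated, the product of the denominators of its
  generators works for all of them, and then for all of \<open>p\<close>, because the elements that
  \<open>s\<close> multiplies into \<open>\<pi>R\<close> form an ideal.\<close>

lemma (in noetherian_domain) uniformizer_common_denominator:
  assumes p: "primeideal p R" and L: "discrete_valuation_ring (localization_at R p)"
  obtains \<pi> s where "\<pi> \<in> p" "\<pi> \<noteq> \<zero>" "s \<in> carrier R" "s \<notin> p"
    "\<And>y. y \<in> p \<Longrightarrow> \<exists>b\<in>carrier R. s \<otimes> y = \<pi> \<otimes> b"
proof -
  note pid = primeideal.axioms(1)[OF p]
  obtain \<pi> where \<pi>: "\<pi> \<in> p" "\<pi> \<noteq> \<zero>"
      "\<forall>y\<in>p. \<exists>t\<in>carrier R - p. \<exists>b\<in>carrier R. t \<otimes> y = \<pi> \<otimes> b"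
    using uniformizer[OF p L] by (elim bexE conjE)
  have \<pi>c: "\<pi> \<in> carrier R" by (rule ideal.Icarr[OF pid \<pi>(1)])
  obtain G where G: "G \<subseteq> carrier R" "finite G" "p = Idl G" using finetely_gen[OF pid] by blast
  have "\<exists>s\<in>carrier R - p. \<forall>y\<in>H. \<exists>b\<in>carrier R. s \<otimes> y = \<pi> \<otimes> b" if "finite H" "H \<subseteq> p" for H
    using that
  proof (induction H rule: finite_induct)
    case empty
    show ?case using denominator_one[OF p] by auto
  next
    case (insert x H)
    then obtain s where s: "s \<in> carrier R - p" "\<forall>y\<in>H. \<exists>b\<in>carrier R. s \<otimes> y = \<pi> \<otimes> b" by blast
    obtain t b where t: "t \<in> carrier R - p" "b \<in> carrier R" "t \<otimes> x = \<pi> \<otimes> b" using \<pi>(3) insert by blast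
    have xc: "x \<in> carrier R" using insert ideal.Icarr[OF pid] by blast
    have "\<exists>b\<in>carrier R. (s \<otimes> t) \<otimes> y = \<pi> \<otimes> b" if y: "y \<in> insert x H" for y
    proof (cases "y = x")
      case True
      have "(s \<otimes> t) \<otimes> x = s \<otimes> (\<pi> \<otimes> b)" using s t xc by (simp add: m_assoc)
      also have "\<dots> = \<pi> \<otimes> (s \<otimes> b)" using s t \<pi>c by (simp add: m_lcomm)
      finally show ?thesis using True s t by blast
    next
      case False
      then obtain b' where b': "b' \<in> carrier R" "s \<otimes> y = \<pi> \<otimes> b'" using y s by blast
      have yc: "y \<in> carrier R" using y insert.prems ideal.Icarr[OF pid] by blast
      have "(s \<otimes> t) \<otimes> y = t \<otimes> (s \<otimes> y)" using s t yc by (simp add: m_ac)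
      also have "\<dots> = \<pi> \<otimes> (t \<otimes> b')" using b' t \<pi>c by (simp add: m_lcomm)
      finally show ?thesis using b' t by blast
    qed
    then show ?case using denominator_mult[OF p s(1) t(1)] by blast
  qed
  moreover have "G \<subseteq> p" using G genideal_self by blast
  ultimately obtain s where s: "s \<in> carrier R - p" "\<forall>y\<in>G. \<exists>b\<in>carrier R. s \<otimes> y = \<pi> \<otimes> b"
    using G(2) by blast
  have sc: "s \<in> carrier R" using s by blast
  note P\<pi> = cgenideal_ideal[OF \<pi>c]
  have "ideal {y \<in> carrier R. s \<otimes> y \<in> PIdl \<pi>} R"
    using sc ideal_zero_mem[OF P\<pi>] ideal_add_mem[OF P\<pi>] ideal.I_l_closed[OF P\<pi>]
    by (intro idealI_comm) (auto simp: r_distr m_lcomm)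
  moreover have "G \<subseteq> {y \<in> carrier R. s \<otimes> y \<in> PIdl \<pi>}" using s(2) G(1) mem_PIdl_iff[OF \<pi>c] by blast
  ultimately have "p \<subseteq> {y \<in> carrier R. s \<otimes> y \<in> PIdl \<pi>}" unfolding G(3) by (rule genideal_minimal)
  then show thesis using that[OF \<pi>(1,2)] s(1) mem_PIdl_iff[OF \<pi>c] by blast
qed

section \<open>Krull dimension and prime chains\<close>

context cring
begin

lemma krull_dim_eq_Sup_prime_chain: "krull_dim R = Sup {enat l | l. \<exists>P. prime_chain {} P l}"
  unfolding krull_dim_def prime_chain_def by simp

lemma coset_mem_image_iff:
  assumes p: "ideal p R" and J: "ideal J R" "p \<subseteq> J" and a: "a \<in> carrier R"
  shows "p +> a \<in> (+>) p ` J \<longleftrightarrow> a \<in> J"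
proof
  assume "p +> a \<in> (+>) p ` J"
  then obtain j where j: "j \<in> J" "p +> a = p +> j" by blast
  have jc: "j \<in> carrier R" by (rule ideal.Icarr[OF J(1) j(1)])
  have "a \<ominus> j \<in> J" using quotient_eq_iff_same_a_r_cos[OF p a jc] j(2) J(2) by blast
  then have "(a \<ominus> j) \<oplus> j \<in> J" using j ideal_add_mem[OF J(1)] by blast
  then show "a \<in> J" using minus_add_cancel[OF a jc] by simp
qed auto

lemma primeideal_quotient_image:
  assumes p: "ideal p R" and J: "primeideal J R" "p \<subseteq> J"
  shows "primeideal ((+>) p ` J) (R Quot p)"
proof (rule primeidealI)
  note Jid = primeideal.axioms(1)[OF J(1)]
  note iff = coset_mem_image_iff[OF p Jid J(2)]
  show "ideal ((+>) p ` J) (R Quot p)" by (rule ring_ideal_imp_quot_ideal[OF p Jid])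
  show "cring (R Quot p)" by (rule ideal.quotient_is_cring[OF p is_cring])
  have carr: "carrier (R Quot p) = (+>) p ` carrier R"
    by (auto simp: FactRing_def A_RCOSETS_def')
  show "carrier (R Quot p) \<noteq> (+>) p ` J"
  proof
    assume "carrier (R Quot p) = (+>) p ` J"
    then have "carrier R \<subseteq> J" using iff unfolding carr by (intro subsetI) (metis imageI)
    then show False using primeideal.I_notcarr[OF J(1)] ideal_subset_carrier[OF Jid] by blast
  qed
  fix X Y assume "X \<in> carrier (R Quot p)" "Y \<in> carrier (R Quot p)"
    and XY: "X \<otimes>\<^bsub>R Quot p\<^esub> Y \<in> (+>) p ` J"
  then obtain a b where ab: "a \<in> carrier R" "b \<in> carrier R" "X = p +> a" "Y = p +> b" unfolding carr by blast
  have "X \<otimes>\<^bsub>R Quot p\<^esub> Y = p +> (a \<otimes> b)"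
    using ab ideal.rcoset_mult_add[OF p] by (simp add: FactRing_def)
  then have "a \<otimes> b \<in> J" using XY iff ab by simp
  then show "X \<in> (+>) p ` J \<or> Y \<in> (+>) p ` J" using primeideal.I_prime[OF J(1)] ab iff by blast
qed

text \<open>Chains of primes are carried across the quotient map by preimages one way and images the
  other. Strictness survives because the map is onto and the primes of \<open>R\<close> involved
  contain its kernel.\<close>

lemma krull_dim_quotient:
  assumes p: "ideal p R"
  shows "krull_dim (R Quot p) = Sup {enat l | l. \<exists>P. prime_chain p P l}"
proof -
  have carr: "carrier (R Quot p) = (+>) p ` carrier R"
    by (auto simp: FactRing_def A_RCOSETS_def')
  have zero: "\<zero>\<^bsub>R Quot p\<^esub> = p" by (simp add: FactRing_def)
  note vimage = ring_hom_ring.primeideal_vimage[OF ideal.rcos_ring_hom_ring[OF p] is_cring]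
  have "\<exists>P. prime_chain p P n"
    if Q: "\<And>i. i \<le> n \<Longrightarrow> primeideal (Q i) (R Quot p)" "\<And>i. i < n \<Longrightarrow> Q i \<subset> Q (Suc i)" for n Q
  proof -
    define P where "P i = {r \<in> carrier R. p +> r \<in> Q i}" for i
    have "primeideal (P i) R \<and> p \<subseteq> P i" if i: "i \<le> n" for i
    proof
      show "primeideal (P i) R" unfolding P_def by (rule vimage[OF Q(1)[OF i]])
      have "p \<in> Q i"
        using additive_subgroup.zero_closed[OF ideal.axioms(1)[OF primeideal.axioms(1)[OF Q(1)[OF i]]]]
        unfolding zero .
      then show "p \<subseteq> P i" unfolding P_def by (simp add: subset_iff a_rcos_zero[OF p] ideal.Icarr[OF p])
    qed
    moreover have "P i \<subset> P (Suc i)" if i: "i < n" for i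
    proof -
      obtain X where X: "X \<in> Q (Suc i)" "X \<notin> Q i" using Q(2)[OF i] by blast
      have "X \<in> carrier (R Quot p)"
        using ideal.Icarr[OF primeideal.axioms(1)[OF Q(1)[of "Suc i"]] X(1)] i by simp
      then obtain r where "r \<in> carrier R" "X = p +> r" unfolding carr by blast
      then show ?thesis using X Q(2)[OF i] by (auto simp: P_def)
    qed
    ultimately show ?thesis unfolding prime_chain_def by blast
  qed
  moreover have "\<exists>Q. (\<forall>i\<le>n. primeideal (Q i) (R Quot p)) \<and> (\<forall>i<n. Q i \<subset> Q (Suc i))"
    if P: "prime_chain p P n" for n P
  proof (intro exI conjI allI impI)
    have Pi: "primeideal (P i) R" "p \<subseteq> P i" if "i \<le> n" for i using P that unfolding prime_chain_def by auto
    show "primeideal ((+>) p ` P i) (R Quot p)" if "i \<le> n" for i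
      by (rule primeideal_quotient_image[OF p Pi[OF that]])
    show "(+>) p ` P i \<subset> (+>) p ` P (Suc i)" if i: "i < n" for i
    proof -
      have lt: "P i \<subset> P (Suc i)" using P i unfolding prime_chain_def by blast
      then obtain x where x: "x \<in> P (Suc i)" "x \<notin> P i" by blast
      have i': "i \<le> n" "Suc i \<le> n" using i by auto
      have "x \<in> carrier R" by (rule ideal.Icarr[OF primeideal.axioms(1)[OF Pi(1)[OF i'(2)]] x(1)])
      then have "p +> x \<notin> (+>) p ` P i"
        using coset_mem_image_iff[OF p primeideal.axioms(1)[OF Pi(1)[OF i'(1)]] Pi(2)[OF i'(1)]] x by blast
      then show ?thesis using lt x(1) by blast
    qed
  qed
  ultimately have "(\<exists>Q. (\<forall>i\<le>n. primeideal (Q i) (R Quot p)) \<and> (\<forall>i<n. Q i \<subset> Q (Suc i))) \<longleftrightarrow>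
      (\<exists>P. prime_chain p P n)" for n by blast
  then show ?thesis unfolding krull_dim_def by simp
qed

end

theorem corollary4p4:
  fixes A :: "('a, 'b) ring_scheme" and p :: "'a set"
  assumes "noetherian_domain A"
    and "local_ring A"
    and "primeideal p A"
    and "discrete_valuation_ring (localization_at A p)"
    and "\<And>n::nat. symbolic_power A p n = p [^]\<^bsub>ideals_set A\<^esub> n"
  shows "krull_dim A = 1 + krull_dim (A Quot p)"
proof -
  interpret A: noetherian_domain A by (rule assms(1))
  note p = assms(3) and pid = primeideal.axioms(1)[OF assms(3)]
  have L: "ring (localization_at A p)"
  proof -
    interpret L: discrete_valuation_ring "localization_at A p" by (rule assms(4))
    show ?thesis by (rule L.ring_axioms)
  qed
  obtain M where M: "maximalideal M A" and uniq: "\<And>M'. maximalideal M' A \<Longrightarrow> M' = M"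
    using local_ring.ex1_maximalideal[OF assms(2)] by blast
  have loc: "J \<subseteq> M" if "ideal J A" "J \<noteq> carrier A" for J
    using A.subset_maximalideal[OF that] uniq by blast
  have pM: "p \<subseteq> M" using loc[OF pid] primeideal.I_notcarr[OF p] by blast
  obtain \<pi> s where \<pi>: "\<pi> \<in> p" "\<pi> \<noteq> \<zero>\<^bsub>A\<^esub>" and s: "s \<in> carrier A" "s \<notin> p"
    and sp: "\<And>y. y \<in> p \<Longrightarrow> \<exists>b\<in>carrier A. s \<otimes>\<^bsub>A\<^esub> y = \<pi> \<otimes>\<^bsub>A\<^esub> b"
    by (rule A.uniformizer_common_denominator[OF p assms(4)]) blast
  have primary: "x \<in> p [^]\<^bsub>ideals_set A\<^esub> n"
    if "t \<in> carrier A" "t \<notin> p" "x \<in> carrier A" "t \<otimes>\<^bsub>A\<^esub> x \<in> p [^]\<^bsub>ideals_set A\<^esub> n" for n :: nat and t x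
    using A.symbolic_power_primary[OF p L _ that(3,4)] that(1,2)
      A.ideal_subset_carrier[OF A.ideal_ideal_power[OF pid]] assms(5) by blast
  have chain_le: "l \<le> Suc d" if "A.coheight_le p d" "A.prime_chain I P l" for d I P l
    by (rule A.prime_chain_length_le[OF p maximalideal.axioms(1)[OF M] pM \<pi> s sp primary M loc that])
  \<comment> \<open>The zero ideal is prime in a domain and lies strictly below \<open>p\<close>,
    which contains the nonzero \<open>\<pi>\<close>.\<close>
  have chain_Suc: "\<exists>P. A.prime_chain {} P (Suc l)" if P: "A.prime_chain p P l" for P l
  proof (intro exI)
    have "{\<zero>\<^bsub>A\<^esub>} \<subset> p" using \<pi> A.ideal_zero_mem[OF pid] by blast
    moreover have "p \<subseteq> P 0" using P unfolding A.prime_chain_def by blast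
    ultimately have "{\<zero>\<^bsub>A\<^esub>} \<subset> P 0" by (rule psubset_subset_trans)
    then show "A.prime_chain {} (\<lambda>j. case j of 0 \<Rightarrow> {\<zero>\<^bsub>A\<^esub>} | Suc j \<Rightarrow> P j) (Suc l)"
      using P A.zeroprimeideal unfolding A.prime_chain_def
      by (auto split: nat.split simp: less_Suc_eq_0_disj)
  qed
  have triv: "A.prime_chain p (\<lambda>_. p) 0" using p by (simp add: A.prime_chain_def)
  show ?thesis
  proof (rule antisym)
    show "krull_dim A \<le> 1 + krull_dim (A Quot p)"
    proof (cases "krull_dim (A Quot p)")
      case (enat d)
      have "enat l \<le> enat d" if "A.prime_chain p P l" for P l
        unfolding enat[symmetric] A.krull_dim_quotient[OF pid] using that by (intro Sup_upper) blast
      then have "A.coheight_le p d" by (auto simp: A.coheight_le_def)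
      then have "krull_dim A \<le> enat (Suc d)"
        unfolding A.krull_dim_eq_Sup_prime_chain using chain_le by (intro Sup_least) auto
      then show ?thesis using enat by (simp add: one_enat_def)
    qed simp
    show "1 + krull_dim (A Quot p) \<le> krull_dim A"
    proof (cases "krull_dim A")
      case (enat N)
      have le: "Suc l \<le> N" if "A.prime_chain p P l" for P l
      proof -
        have "enat (Suc l) \<le> krull_dim A"
          unfolding A.krull_dim_eq_Sup_prime_chain using chain_Suc[OF that] by (intro Sup_upper) blast
        then show ?thesis using enat by simp
      qed
      \<comment> \<open>The truncated subtraction is harmless: by \<open>triv\<close> and
        \<open>le\<close>, \<open>1 \<le> N\<close>.\<close>
      have "krull_dim (A Quot p) \<le> enat (N - 1)"
        unfolding A.krull_dim_quotient[OF pid] using le by (intro Sup_least) fastforce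
      then have "1 + krull_dim (A Quot p) \<le> 1 + enat (N - 1)" by (rule add_left_mono)
      also have "\<dots> = enat N" using le[OF triv] by (simp add: one_enat_def)
      finally show ?thesis using enat by simp
    qed simp
  qed
qed

end
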